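(* Each of the following triangle-free graphs $G$, with $n$ denoting its number of vertices, has asymptotic guessing number $\operatorname{gn}(G)$ larger than $n/2$; more precisely: (a) The Clebsch graph $G$ on $16$ vertices satisfies $10 \leq \operatorname{gn}(G) \leq 11$. (b) The Hoffman--Singleton graph $G$ on $50$ vertices satisfies $29 \leq \operatorname{gn}(G) \leq 35$. (c) The Gewirtz graph $G$ on $56$ vertices satisfies $36 \leq \operatorname{gn}(G) \leq 40$. (d) The $M_{22}$ graph $G$ on $77$ vertices satisfies $55 \leq \operatorname{gn}(G) \leq 56$. (e) The Higman--Sims graph $G$ on $100$ vertices satisfies $77 \leq \operatorname{gn}(G) \leq 78$.
   Context: All graphs are finite, undirected and simple (no loops, no multiple edges). For a graph $G$ and a vertex $v \in V(G)$, $\Gamma(v) = \{u : uv \in E(G)\}$ is the neighbourhood of $v$. Guessing game. Let $s \geq 2$ be an integer and $A_s = \{0,1,\dots,s-1\}$. In the game $(G,s)$ each vertex $v \in V(G)$ (a player) is assigned a value $a_v \in A_s$, uniformly and independently at random. Player $v$ sees exactly the values $(a_u)_{u \in \Gamma(v)}$ (knowing which value belongs to which neighbour) and guesses its own value. A strategy $\mathcal{F} = (f_v)_{v \in V(G)}$ is a tuple of deterministic functions $f_v : A_s^{\Gamma(v)} \to A_s$. The event $\mathrm{Win}(G,s,\mathcal{F})$ is that $f_v((a_u)_{u\in\Gamma(v)}) = a_v$ for all $v \in V(G)$. Define $$\operatorname{gn}(G,s) = |V(G)| + \log_s\Big(\max_{\mathcal{F}} \mathbf{P}[\mathrm{Win}(G,s,\mathcal{F})]\Big),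 \qquad \operatorname{gn}(G) = \lim_{s \to \infty} \operatorname{gn}(G,s);$$ the limit, called the asymptotic guessing number, is known to exist for every graph $G$. Steiner system. The Steiner system $S(3,6,22)$ is a family of $6$-element subsets (blocks) of $\{1,\dots,22\}$ (points) such that each $3$-element subset of $\{1,\dots,22\}$ is contained in exactly one block; it exists and is unique up to isomorphism. It has $77$ blocks. The graphs. - Clebsch graph (strongly regular with parameters $(16,5,2)$): let $S = \{1,2,3,4,5\}$. The vertices are all subsets of $S$ of size $1$ or $2$, together with one extra vertex $\infty$. Edges: $\infty$ is adjacent to every $1$-subset; a $1$-subset $u$ is adjacent to a $2$-subset $v$ iff $u \subset v$; two $2$-subsets are adjacent iff they are disjoint; there are no other edges. - Hoffman--Singleton graph (strongly regular with parameters $(50,7,1)$): take five $5$-cycles $C_h$ ($h \in \mathbb{Z}/5$), each with vertices indexed by $j\in\mathbb{Z}/5$ and $j$ adjacent to $j\pm1$, and five complements of $5$-cycles $C_i^c$ ($i \in \mathbb{Z}/5$), each with vertices indexed by $j\in\mathbb{Z}/5$ and $j$ adjacent to $j\pm 2$; all $50$ vertices are distinct. In addition, join vertex $j$ of $C_h$ to vertex $hi+j \pmod 5$ of $C_i^c$, for all $h,i,j$. - Gewirtz graph (strongly regular with parameters $(56,10,2)$): fix a point of $S(3,6,22)$; the vertices are the $56$ blocks not containing that point, two being adjacent iff they are disjoint. - $M_{22}$ graph (strongly regular with parameters $(77,16,4)$): the vertices are the $77$ blocks of $S(3,6,22)$, two being adjacent iff they are disjoint. - Higman--Sims graph (strongly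 regular with parameters $(100,22,6)$): the vertices are the $22$ points and the $77$ blocks of $S(3,6,22)$ together with one extra vertex $\infty$. Edges: $\infty$ is adjacent to every point; a point is adjacent to a block iff it lies in the block; two blocks are adjacent iff they are disjoint; there are no other edges. (In the parameters $(n,k,\mu)$ of a triangle-free strongly regular graph, $n$ is the number of vertices, $k$ is the valency, and $\mu$ is the number of common neighbours of two distinct non-adjacent vertices.) *)

theory Defs
  imports "HOL-Probability.Probability" "HOL-Library.Numeral_Type"
begin

section \<open>Graphs\<close>

type_synonym 'a graph = "'a set \<times> 'a set set"

abbreviation verts :: "'a graph \<Rightarrow> 'a set" where "verts \<equiv> fst"
abbreviation edges :: "'a graph \<Rightarrow> 'a set set" where "edges \<equiv> snd"

definition simple_graph :: "'a graph \<Rightarrow> bool" where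
  "simple_graph G \<longleftrightarrow> finite (verts G) \<and> (\<forall>e\<in>edges G. e \<subseteq> verts G \<and> card e = 2)"

definition nbhd :: "'a graph \<Rightarrow> 'a \<Rightarrow> 'a set" where
  "nbhd G v = {u. {u, v} \<in> edges G}"

definition triangle_free :: "'a graph \<Rightarrow> bool" where
  "triangle_free G \<longleftrightarrow>
     \<not> (\<exists>u v w. {u, v} \<in> edges G \<and> {v, w} \<in> edges G \<and> {u, w} \<in> edges G)"

section \<open>The guessing game\<close>

definition strategies :: "'a graph \<Rightarrow> nat \<Rightarrow> ('a \<Rightarrow> ('a \<Rightarrow> nat) \<Rightarrow> nat) set" where
  "strategies G s =
     (\<Pi>\<^sub>E v\<in>verts G. (nbhd G v \<rightarrow>\<^sub>E {..<s}) \<rightarrow>\<^sub>E {..<s})"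

text \<open>The product distribution: the values are independent and uniform on \<open>{..<s}\<close>
  (off the vertex set an assignment takes the value \<open>undefined\<close>).\<close>

definition random_assignment :: "'a graph \<Rightarrow> nat \<Rightarrow> ('a \<Rightarrow> nat) pmf" where
  "random_assignment G s = Pi_pmf (verts G) undefined (\<lambda>_. pmf_of_set {..<s})"

definition Win :: "'a graph \<Rightarrow> ('a \<Rightarrow> ('a \<Rightarrow> nat) \<Rightarrow> nat) \<Rightarrow> ('a \<Rightarrow> nat) set" where
  "Win G F = {a. \<forall>v\<in>verts G. F v (restrict a (nbhd G v)) = a v}"

definition gn_s :: "'a graph \<Rightarrow> nat \<Rightarrow> real" where
  "gn_s G s = real (card (verts G)) +
     log (real s)
       (Max ((\<lambda>F. measure_pmf.prob (random_assignment G s) (Win G F)) ` strategies G s))"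

text \<open>The limit is known to exist for every finite simple graph; the values at \<open>s < 2\<close> are
  irrelevant to it.\<close>

definition gn :: "'a graph \<Rightarrow> real" where
  "gn G = lim (\<lambda>s. gn_s G s)"

section \<open>The graphs\<close>

datatype clebsch_vertex = CInfty | CSet "nat set"

definition clebsch_graph :: "clebsch_vertex graph" where
  "clebsch_graph =
     (insert CInfty {CSet u | u. u \<subseteq> {1..5} \<and> (card u = 1 \<or> card u = 2)},
      {{CInfty, CSet u} | u. u \<subseteq> {1..5} \<and> card u = 1}
      \<union> {{CSet u, CSet v} | u v.
            u \<subseteq> {1..5} \<and> v \<subseteq> {1..5} \<and> card u = 1 \<and> card v = 2 \<and> u \<subseteq> v}
      \<union> {{CSet u, CSet v} | u v.
            u \<subseteq> {1..5} \<and> v \<subseteq> {1..5} \<and> card u = 2 \<and> card v = 2 \<and> u \<inter> v = {}})"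

text \<open>\<open>Cyc h j\<close> is vertex \<open>j\<close> of the \<open>h\<close>-th 5-cycle and \<open>CoCyc i j\<close> is vertex \<open>j\<close> of the
  \<open>i\<close>-th complement of a 5-cycle. The indices live in the numeral type \<open>5\<close>, whose arithmetic
  is that of the integers modulo 5.\<close>

datatype hs_vertex = Cyc 5 5 | CoCyc 5 5

definition hoffman_singleton_graph :: "hs_vertex graph" where
  "hoffman_singleton_graph =
     (UNIV,
      {{Cyc h j, Cyc h k} | h j k. k = j + 1 \<or> k = j - 1}
      \<union> {{CoCyc i j, CoCyc i k} | i j k. k = j + 2 \<or> k = j - 2}
      \<union> {{Cyc h j, CoCyc i (h * i + j)} | h i j. True})"

definition steiner_system :: "nat \<Rightarrow> nat \<Rightarrow> 'a set \<Rightarrow> 'a set set \<Rightarrow> bool" where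
  "steiner_system t k X \<B> \<longleftrightarrow>
     finite X \<and> (\<forall>b\<in>\<B>. b \<subseteq> X \<and> card b = k) \<and>
     (\<forall>T. T \<subseteq> X \<and> card T = t \<longrightarrow> (\<exists>!b. b \<in> \<B> \<and> T \<subseteq> b))"

abbreviation S_3_6_22 :: "nat set set \<Rightarrow> bool" where
  "S_3_6_22 \<equiv> steiner_system 3 6 {1..22}"

definition disjointness_graph :: "'a set set \<Rightarrow> 'a set graph" where
  "disjointness_graph \<B> = (\<B>, {{b, c} | b c. b \<in> \<B> \<and> c \<in> \<B> \<and> b \<inter> c = {}})"

definition gewirtz_graph :: "nat set set \<Rightarrow> nat \<Rightarrow> nat set graph" where
  "gewirtz_graph \<B> p = disjointness_graph {b \<in> \<B>. p \<notin> b}"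

definition M22_graph :: "nat set set \<Rightarrow> nat set graph" where
  "M22_graph \<B> = disjointness_graph \<B>"

datatype higman_sims_vertex = HInfty | Point nat | Block "nat set"

definition higman_sims_graph :: "nat set set \<Rightarrow> higman_sims_vertex graph" where
  "higman_sims_graph \<B> =
     ({HInfty} \<union> Point ` {1..22} \<union> Block ` \<B>,
      {{HInfty, Point x} | x. x \<in> {1..22}}
      \<union> {{Point x, Block b} | x b. x \<in> {1..22} \<and> b \<in> \<B> \<and> x \<in> b}
      \<union> {{Block b, Block c} | b c. b \<in> \<B> \<and> c \<in> \<B> \<and> b \<inter> c = {}})"

lemma steiner_system_finite: "steiner_system t k X \<B> \<Longrightarrow> finite \<B>"
  by (rule finite_subset[of _ "Pow X"]) (auto simp: steiner_system_def)

lemma simple_graph_clebsch: "simple_graph clebsch_graph"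
proof -
  have "finite {CSet u | u. u \<subseteq> {1..5} \<and> (card u = 1 \<or> card u = 2)}"
    by (rule finite_subset[of _ "CSet ` Pow {1..5}"]) auto
  moreover have "card {CInfty, CSet u} = 2" for u
    by simp
  moreover have "card {CSet u, CSet v} = 2" if "card u = 1" "card v = 2" for u v
    using that by (cases "u = v") auto
  moreover have "card {CSet u, CSet v} = 2" if "card u = 2" "u \<inter> v = {}" for u v
    using that by (cases "u = v") auto
  ultimately show ?thesis
    unfolding simple_graph_def clebsch_graph_def by fastforce
qed

lemma simple_graph_hoffman_singleton: "simple_graph hoffman_singleton_graph"
proof -
  have "(UNIV :: hs_vertex set) = range (case_prod Cyc) \<union> range (case_prod CoCyc)"
    by (auto simp: image_iff) (metis hs_vertex.exhaust)
  then have "finite (UNIV :: hs_vertex set)"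
    by (metis finite_Un finite_imageI finite)
  moreover have "(1::5) \<noteq> 0" "(2::5) \<noteq> 0"
    by simp_all
  ultimately show ?thesis
    unfolding simple_graph_def hoffman_singleton_graph_def
    by (auto simp: card_insert_if)
qed

lemma simple_graph_disjointness:
  assumes "finite \<B>" "{} \<notin> \<B>"
  shows "simple_graph (disjointness_graph \<B>)"
proof -
  have "card {b, c} = 2" if "b \<in> \<B>" "b \<inter> c = {}" for b c
    using that assms(2) by (cases "b = c") auto
  then show ?thesis
    using assms(1) unfolding simple_graph_def disjointness_graph_def by auto
qed

lemma simple_graph_higman_sims:
  assumes "S_3_6_22 \<B>"
  shows "simple_graph (higman_sims_graph \<B>)"
proof -
  have "{} \<notin> \<B>" using assms by (auto simp: steiner_system_def)
  then have "card {Block b, Block c} = 2" if "b \<in> \<B>" "b \<inter> c = {}" for b c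
    using that by (cases "b = c") auto
  then show ?thesis
    using steiner_system_finite[OF assms]
    unfolding simple_graph_def higman_sims_graph_def by (auto simp: card_insert_if)
qed

end

theory Submission
  imports Defs "HOL-Real_Asymp.Real_Asymp"
begin

text \<open>
  Write \<open>M(s)\<close> for the largest number of assignments over \<open>s\<close> values that one strategy can get
  right at every vertex. A set of assignments can be won simultaneously as soon as, on it, the values
  around each vertex determine the value at the vertex, so \<open>M(s)\<close> is the largest size of such a
  set and \<open>gn_s G s = log\<^sub>s M(s)\<close>. Encoding a pair of values as one value over a larger alphabet gives
  \<open>M(s) M(t) \<le> M(s t)\<close>; with monotonicity of \<open>M\<close> this makes \<open>log\<^sub>s M(s)\<close> converge to its
  supremum over \<open>s \<ge> 2\<close> (\<open>gn_s_tendsto_gn\<close>). Hence an upper bound for all \<open>s\<close> bounds the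
  guessing number from above, and one well chosen \<open>s\<close> bounds it from below.

  For the upper bounds, no vertex of an independent set sees another vertex of that set, so a winning
  assignment is determined by its values outside it and \<open>gn G \<le> n - |I|\<close>
  (\<open>gn_le_independent\<close>). Independent sets of sizes 5, 15, 16, 21, 22 are: the five singletons
  of the Clebsch graph; a parabola together with the pairs of vertices it misses in the
  Hoffman--Singleton graph; the blocks through a point (avoiding the deleted one) in the Gewirtz
  graph; the blocks through a point in the \<open>M\<^sub>2\<^sub>2\<close> graph; the 22 points of the Higman--Sims graph.

  For the lower bounds, suppose that \<open>m\<close> integer-linear checks modulo \<open>s\<close> have the property that
  whenever they all vanish on \<open>d\<close> and \<open>d\<close> is zero around \<open>v\<close>, then \<open>d v\<close> is zero modulo \<open>s\<close>. Some
  fibre of the checks has at least \<open>s^(n - m)\<close> elements, and it can be won, so \<open>gn G \<ge> n - m\<close>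
  (\<open>gn_ge_additive_checks\<close>). The checks come from \<open>A - \<theta> I\<close>, where \<open>A\<close> is the adjacency matrix and
  \<open>\<theta>\<close> an eigenvalue of large multiplicity (2, or 1 for the Clebsch graph), reduced modulo a prime that
  makes the rank of \<open>A - \<theta> I\<close> small.

  In four of the graphs the prime is 3 (2 for the Clebsch graph) and the rank is small because of a
  point-block structure: for blocks \<open>b\<close>, \<open>c\<close> the number \<open>1 + |b \<inter> c|\<close> is 1 if they are
  disjoint, 0 modulo the prime if they meet properly, and 1 modulo the prime if they coincide. So the
  row of \<open>A + I\<close> at a block is a sum of the check \<open>t\<close> adding up all blocks and the checks \<open>x\<^sub>i\<close>
  adding up the blocks through the point \<open>i\<close> (\<open>block_determined\<close>). The size of a block is
  divisible by the prime. Hence in the \<open>M\<^sub>2\<^sub>2\<close> graph the \<open>x\<^sub>i\<close> sum to zero, so that one of them need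
  not be checked, and in the Gewirtz graph it is even enough that all \<open>x\<^sub>i\<close> agree. In the Clebsch and
  Higman--Sims graphs, the rows at the points and the check \<open>t\<close> imply all other rows
  (\<open>point_block_checks\<close>).

  The Hoffman--Singleton graph is treated modulo 5, where a vector is a pair of functions on the affine
  plane over the field of five elements. There the rows of \<open>A - 2 I\<close> satisfy so many relations that
  21 of them vanish only if all do (\<open>hs_checks_complete\<close>): along each cycle the zeroth moment
  of the rows is constant and the first is affine in the index of the cycle, and once the rows at
  the cycles vanish, those at the co-cycles form an affine function, as their second differences are
  zero.
\<close>

section \<open>Winnable sets of assignments\<close>

text \<open>Being won by one strategy is expressed without mentioning a strategy: the guesses only have to be
  consistent (\<open>winnable_strategy\<close> and \<open>winnable_Win\<close> give the two directions).\<close>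
definition winnable :: "'a graph \<Rightarrow> nat \<Rightarrow> ('a \<Rightarrow> nat) set \<Rightarrow> bool" where
  "winnable G s W \<longleftrightarrow> W \<subseteq> (verts G \<rightarrow>\<^sub>E {..<s}) \<and>
     (\<forall>a\<in>W. \<forall>b\<in>W. \<forall>v\<in>verts G. (\<forall>u\<in>nbhd G v. a u = b u) \<longrightarrow> a v = b v)"

definition max_wins :: "'a graph \<Rightarrow> nat \<Rightarrow> nat" where
  "max_wins G s = Max (card ` {W. winnable G s W})"

lemma nbhd_subset_verts: "simple_graph G \<Longrightarrow> nbhd G v \<subseteq> verts G"
  by (auto simp: simple_graph_def nbhd_def)

lemma finite_winnable:
  assumes "finite (verts G)"
  shows "finite {W. winnable G s W}"
proof -
  have "finite (verts G \<rightarrow>\<^sub>E {..<s})" using assms by (simp add: finite_PiE)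
  moreover have "{W. winnable G s W} \<subseteq> Pow (verts G \<rightarrow>\<^sub>E {..<s})"
    by (auto simp: winnable_def)
  ultimately show ?thesis by (meson finite_Pow_iff finite_subset)
qed

lemma winnable_empty: "winnable G s {}"
  by (simp add: winnable_def)

lemma card_le_max_wins:
  assumes "finite (verts G)" "winnable G s W"
  shows "card W \<le> max_wins G s"
  unfolding max_wins_def using finite_winnable[OF assms(1)] assms(2) by (intro Max_ge) auto

lemma max_wins_attained:
  assumes "finite (verts G)"
  obtains W where "winnable G s W" "card W = max_wins G s"
proof -
  have "max_wins G s \<in> card ` {W. winnable G s W}"
    unfolding max_wins_def using finite_winnable[OF assms] winnable_empty[of G s]
    by (intro Max_in) blast+
  then show ?thesis using that by auto
qed

lemma winnable_Win:
  "winnable G s (Win G F \<inter> (verts G \<rightarrow>\<^sub>E {..<s}))"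
proof -
  have "a v = b v"
    if "a \<in> Win G F" "b \<in> Win G F" "v \<in> verts G" "\<forall>u\<in>nbhd G v. a u = b u" for a b v
  proof -
    have "restrict a (nbhd G v) = restrict b (nbhd G v)"
      using that(4) by (auto simp: restrict_def)
    moreover have "F v (restrict a (nbhd G v)) = a v" "F v (restrict b (nbhd G v)) = b v"
      using that(1-3) by (auto simp: Win_def)
    ultimately show ?thesis by simp
  qed
  then show ?thesis unfolding winnable_def by blast
qed

text \<open>The function that each vertex needs is well defined on the views that occur in \<open>W\<close>; other
  views may be answered arbitrarily, here by \<open>0\<close>.\<close>
lemma winnable_strategy:
  assumes G: "simple_graph G" and s: "0 < s" and W: "winnable G s W"
  obtains F where "F \<in> strategies G s" "W \<subseteq> Win G F"
proof -
  define good where "good v g a \<longleftrightarrow> a \<in> W \<and> restrict a (nbhd G v) = g" for v g a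
  define F where "F = (\<lambda>v\<in>verts G. \<lambda>g\<in>nbhd G v \<rightarrow>\<^sub>E {..<s}.
     if \<exists>a. good v g a then (SOME a. good v g a) v else 0)"
  have PiE: "W \<subseteq> (verts G \<rightarrow>\<^sub>E {..<s})" using W
    by (simp add: winnable_def)
  have "(SOME a. good v g a) v < s" if "v \<in> verts G" "\<exists>a. good v g a" for v g
    using someI_ex[OF that(2)] PiE that(1) unfolding good_def by (auto simp: PiE_def Pi_def)
  then have "F \<in> strategies G s"
    using s by (auto simp: F_def strategies_def)
  moreover have "F v (restrict a (nbhd G v)) = a v" if "a \<in> W" "v \<in> verts G" for a v
  proof -
    let ?g = "restrict a (nbhd G v)"
    have g: "?g \<in> nbhd G v \<rightarrow>\<^sub>E {..<s}"
      using PiE that(1) nbhd_subset_verts[OF G, of v] by (auto simp: PiE_def Pi_def extensional_def)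
    have ex: "\<exists>b. good v ?g b" using that by (auto simp: good_def)
    define b where "b = (SOME b. good v ?g b)"
    have b: "b \<in> W" "restrict b (nbhd G v) = ?g"
      using someI_ex[OF ex] by (auto simp: good_def b_def)
    then have "\<forall>u\<in>nbhd G v. b u = a u" by (metis restrict_apply')
    then have "b v = a v" using W b(1) that by (auto simp: winnable_def)
    moreover have "F v ?g = b v"
      using g ex that(2) by (simp add: F_def b_def)
    ultimately show ?thesis by simp
  qed
  ultimately show ?thesis using that[of F] by (auto simp: Win_def)
qed

lemma prob_Win:
  assumes "finite (verts G)" "0 < s"
  shows "measure_pmf.prob (random_assignment G s) (Win G F)
    = real (card (Win G F \<inter> (verts G \<rightarrow>\<^sub>E {..<s}))) / real s ^ card (verts G)"
proof -
  have ne: "{..<s} \<noteq> {}" using assms(2) by auto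
  have dflt: "PiE_dflt (verts G) undefined (\<lambda>_. {..<s}) = (verts G \<rightarrow>\<^sub>E {..<s})"
    by (auto simp: PiE_dflt_def PiE_def Pi_def extensional_def)
  have "random_assignment G s = pmf_of_set (verts G \<rightarrow>\<^sub>E {..<s})"
    unfolding random_assignment_def
      using Pi_pmf_of_set[of "verts G" "\<lambda>_. {..<s}" undefined] assms ne dflt by simp
  moreover have "finite (verts G \<rightarrow>\<^sub>E {..<s})" using assms
    by (simp add: finite_PiE)
  moreover have "(verts G \<rightarrow>\<^sub>E {..<s}) \<noteq> {}" using ne
    by (simp add: PiE_eq_empty_iff)
  ultimately show ?thesis
    using assms by (simp add: measure_pmf_of_set card_PiE Int_commute)
qed

lemma max_wins_pos:
  assumes "simple_graph G" "0 < s"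
  shows "0 < max_wins G s"
proof -
  have "winnable G s {\<lambda>v\<in>verts G. 0}" using assms(2) by (auto simp: winnable_def)
  from card_le_max_wins[OF _ this] show ?thesis using assms(1) by (simp add: simple_graph_def)
qed

text \<open>The summand \<open>card (verts G)\<close> in the guessing number cancels the \<open>s ^ card (verts G)\<close> equally
  likely assignments.\<close>
lemma gn_s_eq_log_max_wins:
  assumes G: "simple_graph G" and s: "2 \<le> s"
  shows "gn_s G s = log (real s) (real (max_wins G s))"
proof -
  let ?n = "card (verts G)"
  let ?P = "\<lambda>F. measure_pmf.prob (random_assignment G s) (Win G F)"
  have fin: "finite (verts G)" using G by (simp add: simple_graph_def)
  have "finite (nbhd G v)" for v using nbhd_subset_verts[OF G] fin finite_subset by blast
  then have finS: "finite (strategies G s)"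
    using fin unfolding strategies_def by (intro finite_PiE) auto
  obtain W where W: "winnable G s W" "card W = max_wins G s" using max_wins_attained[OF fin] .
  obtain F where F: "F \<in> strategies G s" "W \<subseteq> Win G F"
    using winnable_strategy[OF G _ W(1)] s by auto
  have le: "?P F' \<le> max_wins G s / real s ^ ?n" for F'
    using card_le_max_wins[OF fin winnable_Win[of G s F']] prob_Win[OF fin, of s F'] s
    by (simp add: divide_right_mono)
  have "W \<subseteq> Win G F \<inter> (verts G \<rightarrow>\<^sub>E {..<s})" using F W(1)
    by (simp add: winnable_def)
  then have "card W \<le> card (Win G F \<inter> (verts G \<rightarrow>\<^sub>E {..<s}))"
    using fin by (intro card_mono) (auto simp: finite_PiE)
  then have "max_wins G s / real s ^ ?n \<le> ?P F"
    using W(2) prob_Win[OF fin, of s F] s by (simp add: divide_right_mono)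
  then have "?P F = max_wins G s / real s ^ ?n" using le[of F] by simp
  then have "Max (?P ` strategies G s) = max_wins G s / real s ^ ?n"
    using finS F(1) le by (intro Max_eqI) (auto intro: rev_image_eqI)
  moreover have "log s (max_wins G s / real s ^ ?n) = log s (max_wins G s) - ?n"
    using max_wins_pos[OF G, of s] s by (simp add: log_divide log_nat_power)
  ultimately show ?thesis by (simp add: gn_s_def)
qed

section \<open>Alphabets of different sizes\<close>

lemma max_wins_mono:
  assumes "simple_graph G" "s \<le> t"
  shows "max_wins G s \<le> max_wins G t"
proof -
  have fin: "finite (verts G)" using assms(1) by (simp add: simple_graph_def)
  obtain W where W: "winnable G s W" "card W = max_wins G s" using max_wins_attained[OF fin] .
  have "(verts G \<rightarrow>\<^sub>E {..<s}) \<subseteq> (verts G \<rightarrow>\<^sub>E {..<t})"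
    using assms(2) by (intro PiE_mono) auto
  then have "winnable G t W" using W(1) unfolding winnable_def by blast
  from card_le_max_wins[OF fin this] show ?thesis using W(2) by simp
qed

text \<open>Two games are played at once by writing the pair \<open>(x, y)\<close> as the single value \<open>x + s * y\<close>.\<close>
lemma max_wins_mult:
  assumes G: "simple_graph G"
  shows "max_wins G s * max_wins G t \<le> max_wins G (s * t)"
proof -
  have fin: "finite (verts G)" using assms(1) by (simp add: simple_graph_def)
  obtain W where W: "winnable G s W" "card W = max_wins G s" using max_wins_attained[OF fin] .
  obtain W' where W': "winnable G t W'" "card W' = max_wins G t" using max_wins_attained[OF fin] .
  have rng: "\<And>a v. a \<in> W \<Longrightarrow> v \<in> verts G \<Longrightarrow> a v < s" "\<And>a v. a \<in> W' \<Longrightarrow> v \<in> verts G \<Longrightarrow> a v < t"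
    and ext: "\<And>a. a \<in> W \<Longrightarrow> a \<in> extensional (verts G)" "\<And>a. a \<in> W' \<Longrightarrow> a \<in> extensional (verts G)"
    using W(1) W'(1) unfolding winnable_def by (auto simp: PiE_def Pi_def)
  define enc where "enc = (\<lambda>(a, b). \<lambda>v\<in>verts G. a v + s * b v)"
  have dec: "a v = a' v \<and> b v = b' v"
    if "a \<in> W" "a' \<in> W" "v \<in> verts G" "enc (a, b) v = enc (a', b') v" for a b a' b' v
  proof -
    have eq: "a v + s * b v = a' v + s * b' v" using that by (simp add: enc_def)
    have lt: "a v < s" "a' v < s" using rng that by auto
    then have "(a v + s * b v) mod s = a v" "(a' v + s * b' v) mod s = a' v" by auto
    moreover have "(a v + s * b v) div s = b v" "(a' v + s * b' v) div s = b' v" using lt by auto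
    ultimately show ?thesis using eq by metis
  qed
  have inj: "inj_on enc (W \<times> W')"
  proof (rule inj_onI, clarify)
    fix a b a' b' assume *: "a \<in> W" "b \<in> W'" "a' \<in> W" "b' \<in> W'" "enc (a, b) = enc (a', b')"
    then have "a v = a' v \<and> b v = b' v" if "v \<in> verts G" for v
      using dec[OF *(1,3) that, of b b'] *(5) by simp
    then show "a = a' \<and> b = b'" using ext * by (meson extensionalityI)
  qed
  have "winnable G (s * t) (enc ` (W \<times> W'))"
    unfolding winnable_def
  proof (intro conjI ballI impI)
    have "x + s * y < s * t" if "x < s" "y < t" for x y
    proof -
      have "x + s * y < s * Suc y" using that by simp
      also have "\<dots> \<le> s * t" using that by (intro mult_le_mono2) auto
      finally show ?thesis .
    qed
    then show "enc ` (W \<times> W') \<subseteq> (verts G \<rightarrow>\<^sub>E {..<s * t})"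
      using rng by (auto simp: enc_def)
  next
    fix c c' v assume cc: "c \<in> enc ` (W \<times> W')" "c' \<in> enc ` (W \<times> W')" and v: "v \<in> verts G"
      and eq: "\<forall>u\<in>nbhd G v. c u = c' u"
    from cc obtain a b a' b' where *: "a \<in> W" "b \<in> W'" "a' \<in> W" "b' \<in> W'"
      "c = enc (a, b)" "c' = enc (a', b')" by auto
    have "a u = a' u \<and> b u = b' u" if "u \<in> nbhd G v" for u
      using dec[OF *(1,3)] eq that nbhd_subset_verts[OF G, of v] *(5,6) by blast
    then have "a v = a' v" "b v = b' v"
      using W(1) W'(1) * v unfolding winnable_def by blast+
    then show "c v = c' v" using *(5,6) v by (simp add: enc_def)
  qed
  from card_le_max_wins[OF fin this] show ?thesis
    using W(2) W'(2) by (simp add: card_image[OF inj] card_cartesian_product)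
qed

lemma max_wins_power:
  assumes "simple_graph G"
  shows "max_wins G t ^ k \<le> max_wins G (t ^ k)"
proof (induction k)
  case 0
  then show ?case using max_wins_pos[OF assms, of 1] by simp
next
  case (Suc k)
  have "max_wins G t ^ Suc k \<le> max_wins G t * max_wins G (t ^ k)" using Suc by simp
  also have "\<dots> \<le> max_wins G (t ^ Suc k)" using max_wins_mult[OF assms] by simp
  finally show ?case .
qed

section \<open>Independent sets bound winnable sets\<close>

lemma winnable_card_le_independent:
  assumes fin: "finite (verts G)" and I: "I \<subseteq> verts G" "\<And>u v. u \<in> I \<Longrightarrow> v \<in> I \<Longrightarrow> {u, v} \<notin> edges G"
    and G: "simple_graph G" and W: "winnable G s W"
  shows "card W \<le> s ^ (card (verts G) - card I)"
proof -
  let ?r = "\<lambda>a. restrict a (verts G - I)"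
  have PiE: "W \<subseteq> (verts G \<rightarrow>\<^sub>E {..<s})" using W
    by (simp add: winnable_def)
  have "inj_on ?r W"
  proof (rule inj_onI)
    fix a b assume ab: "a \<in> W" "b \<in> W" "?r a = ?r b"
    have off: "a u = b u" if "u \<in> verts G - I" for u using ab(3) that by (metis restrict_apply')
    have on: "a v = b v" if "v \<in> I" for v
    proof -
      have "nbhd G v \<subseteq> verts G - I"
        using nbhd_subset_verts[OF G, of v] I(2) that unfolding nbhd_def by blast
      then have "\<forall>u\<in>nbhd G v. a u = b u" using off by blast
      then show ?thesis using W ab(1,2) that I(1) unfolding winnable_def by blast
    qed
    show "a = b"
      using off on ab(1,2) PiE by (intro extensionalityI[of _ "verts G"]) (auto simp: PiE_def)
  qed
  moreover have "?r ` W \<subseteq> (verts G - I \<rightarrow>\<^sub>E {..<s})" using PiE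
    by (auto simp: PiE_def Pi_def)
  moreover have "finite (verts G - I \<rightarrow>\<^sub>E {..<s})" using fin
    by (simp add: finite_PiE)
  ultimately have "card W \<le> card (verts G - I \<rightarrow>\<^sub>E {..<s})"
    by (metis card_inj_on_le)
  also have "\<dots> = s ^ (card (verts G) - card I)"
    using fin I(1) by (simp add: card_PiE card_Diff_subset finite_subset)
  finally show ?thesis .
qed

lemma log_max_wins_le_independent:
  assumes G: "simple_graph G" and I: "I \<subseteq> verts G" "\<And>u v. u \<in> I \<Longrightarrow> v \<in> I \<Longrightarrow> {u, v} \<notin> edges G"
    and s: "2 \<le> s"
  shows "log (real s) (real (max_wins G s)) \<le> real (card (verts G)) - real (card I)"
proof -
  have fin: "finite (verts G)" using G by (simp add: simple_graph_def)
  have le: "card I \<le> card (verts G)" using I(1) fin by (simp add: card_mono)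
  obtain W where W: "winnable G s W" "card W = max_wins G s" using max_wins_attained[OF fin] .
  have "real (max_wins G s) \<le> real s ^ (card (verts G) - card I)"
    using winnable_card_le_independent[OF fin I G W(1)] W(2)
    by (metis of_nat_le_iff of_nat_power)
  then have "log s (max_wins G s) \<le> log s (real s ^ (card (verts G) - card I))"
    using max_wins_pos[OF G, of s] s by (intro log_mono) auto
  also have "\<dots> = real (card (verts G)) - real (card I)" using s le
    by (simp add: log_nat_power of_nat_diff)
  finally show ?thesis .
qed

section \<open>The guessing number as a supremum\<close>

text \<open>Playing the game over \<open>t\<close> values \<open>k\<close> times in parallel, for the largest \<open>k\<close> with \<open>t ^ k \<le> s\<close>, wastes
  only the rounding error in \<open>log\<^sub>t s\<close>.\<close>
lemma log_max_wins_almost_mono: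
  assumes G: "simple_graph G" and t: "2 \<le> t" and s: "2 \<le> s"
  shows "log t (max_wins G t) - card (verts G) * ln t / ln s \<le> log s (max_wins G s)"
proof -
  define k where "k = nat \<lfloor>log t s\<rfloor>"
  let ?f = "log t (max_wins G t)"
  have ls: "0 < ln (real s)" and lt: "0 < ln (real t)" using s t by auto
  have pos: "0 < max_wins G t" "0 < max_wins G s" using max_wins_pos[OF G] s t by auto
  have l0: "0 \<le> log t s" using s t by simp
  have k: "k \<le> log t s" "log t s < k + 1" unfolding k_def using l0 by linarith+
  have "real t ^ k \<le> s"
    using k(1) s t by (simp add: le_log_iff powr_realpow)
  then have "t ^ k \<le> s" by (metis of_nat_le_iff of_nat_power)
  then have "max_wins G t ^ k \<le> max_wins G s"
    using max_wins_power[OF G] max_wins_mono[OF G] le_trans by blast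
  then have "real (max_wins G t) ^ k \<le> max_wins G s" by (metis of_nat_le_iff of_nat_power)
  then have "ln (real (max_wins G t) ^ k) \<le> ln (max_wins G s)"
    using pos by (subst ln_le_cancel_iff) auto
  then have *: "k * ln (max_wins G t) \<le> ln (max_wins G s)" using pos by (simp add: ln_realpow)
  have f: "0 \<le> ?f" "?f \<le> card (verts G)"
    using log_max_wins_le_independent[OF G _ _ t, of "{}"] pos t by auto
  have "(log t s - 1) * ln (max_wins G t) \<le> k * ln (max_wins G t)"
    using k(2) pos by (intro mult_right_mono) auto
  then have "(log t s - 1) * ln (max_wins G t) \<le> ln (max_wins G s)" using * by linarith
  moreover have "(log t s - 1) * ln (max_wins G t) = (?f - ?f * ln t / ln s) * ln s"
    using ls lt by (simp add: log_def field_simps)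
  ultimately have "?f - ?f * ln t / ln s \<le> log s (max_wins G s)"
    using ls by (simp add: log_def pos_le_divide_eq)
  moreover have "?f * ln t / ln s \<le> card (verts G) * ln t / ln s"
    using f ls lt by (intro divide_right_mono mult_right_mono) auto
  ultimately show ?thesis by linarith
qed

text \<open>A Fekete-type argument: for fixed \<open>t\<close>, the loss in \<open>log_max_wins_almost_mono\<close> tends to 0 as \<open>s\<close> grows,
  so the limit inferior is at least each \<open>gn_s G t\<close>.\<close>
lemma gn_s_tendsto_gn:
  assumes G: "simple_graph G"
  shows "gn_s G \<longlonglongrightarrow> (SUP t\<in>{2..}. gn_s G t)" and "bdd_above (gn_s G ` {2..})"
proof -
  let ?n = "real (card (verts G))"
  have le_n: "gn_s G t \<le> ?n" if "2 \<le> t" for t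
    using log_max_wins_le_independent[OF G _ _ that, of "{}"] gn_s_eq_log_max_wins[OF G that]
      by simp
  then show bdd: "bdd_above (gn_s G ` {2..})" by (auto simp: bdd_above_def)
  show "gn_s G \<longlonglongrightarrow> (SUP t\<in>{2..}. gn_s G t)"
  proof (rule order_tendstoI)
    fix y assume "(SUP t\<in>{2..}. gn_s G t) < y"
    then have "gn_s G s < y" if "2 \<le> s" for s
      using cSUP_upper[OF _ bdd, of s] that by auto
    then show "\<forall>\<^sub>F s in sequentially. gn_s G s < y"
      by (auto simp: eventually_sequentially)
  next
    fix y assume "y < (SUP t\<in>{2..}. gn_s G t)"
    then obtain t where t: "2 \<le> t" "y < gn_s G t"
      using less_cSUP_iff[OF _ bdd] by auto
    have "(\<lambda>s::nat. gn_s G t - ?n * ln t / ln s) \<longlonglongrightarrow> gn_s G t"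
      by real_asymp
    then have "\<forall>\<^sub>F s in sequentially. y < gn_s G t - ?n * ln t / ln (real s)"
      using t(2) by (simp add: order_tendsto_iff)
    moreover have "\<forall>\<^sub>F s in sequentially. 2 \<le> s" by (rule eventually_ge_at_top)
    ultimately show "\<forall>\<^sub>F s in sequentially. y < gn_s G s"
    proof eventually_elim
      case (elim s)
      then show ?case
        using log_max_wins_almost_mono[OF G t(1) elim(2)]
          gn_s_eq_log_max_wins[OF G t(1)] gn_s_eq_log_max_wins[OF G elim(2)] by simp
    qed
  qed
qed

lemma gn_eq_SUP: "simple_graph G \<Longrightarrow> gn G = (SUP t\<in>{2..}. gn_s G t)"
  unfolding gn_def using gn_s_tendsto_gn(1) by (blast intro: limI)

section \<open>Bounds from independent sets and from linear checks\<close>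

lemma gn_le_independent:
  assumes G: "simple_graph G" and I: "I \<subseteq> verts G" "\<And>u v. u \<in> I \<Longrightarrow> v \<in> I \<Longrightarrow> {u, v} \<notin> edges G"
  shows "gn G \<le> real (card (verts G)) - real (card I)"
  unfolding gn_eq_SUP[OF G]
  using log_max_wins_le_independent[OF G I] gn_s_eq_log_max_wins[OF G]
  by (intro cSUP_least) auto

text \<open>Two assignments with the same check values modulo \<open>s\<close> differ by a \<open>d\<close> on which all checks vanish; so
  each fibre of the check map can be won, and by the pigeonhole principle some fibre is large.\<close>
lemma gn_ge_additive_checks:
  fixes \<Phi> :: "'j \<Rightarrow> ('a \<Rightarrow> int) \<Rightarrow> int"
  assumes G: "simple_graph G" and s: "2 \<le> s" and J: "finite J"
    and diff: "\<And>j a b. j \<in> J \<Longrightarrow> \<Phi> j (\<lambda>v. a v - b v) = \<Phi> j a - \<Phi> j b"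
    and det: "\<And>d v. (\<And>j. j \<in> J \<Longrightarrow> int s dvd \<Phi> j d) \<Longrightarrow> v \<in> verts G \<Longrightarrow>
                (\<And>u. u \<in> nbhd G v \<Longrightarrow> d u = 0) \<Longrightarrow> int s dvd d v"
  shows "real (card (verts G)) - real (card J) \<le> gn G"
proof -
  let ?n = "card (verts G)" and ?m = "card J"
  have fin: "finite (verts G)" using G by (simp add: simple_graph_def)
  define A where "A = (verts G \<rightarrow>\<^sub>E {..<s})"
  define syn where "syn a = (\<lambda>j\<in>J. nat (\<Phi> j (\<lambda>v. int (a v)) mod int s))" for a
  have finA: "finite A" using fin by (simp add: A_def finite_PiE)
  have rng: "syn ` A \<subseteq> (J \<rightarrow>\<^sub>E {..<s})" using s
    by (auto simp: syn_def nat_less_iff)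
  have win: "winnable G s {a \<in> A. syn a = c}" for c
    unfolding winnable_def
  proof (intro conjI ballI impI)
    fix a b v assume ab: "a \<in> {a \<in> A. syn a = c}" "b \<in> {a \<in> A. syn a = c}" and v: "v \<in> verts G"
      and eq: "\<forall>u\<in>nbhd G v. a u = b u"
    let ?d = "\<lambda>v. int (a v) - int (b v)"
    have "int s dvd \<Phi> j ?d" if "j \<in> J" for j
    proof -
      have "syn a j = syn b j" using ab by simp
      then have "\<Phi> j (\<lambda>v. int (a v)) mod int s = \<Phi> j (\<lambda>v. int (b v)) mod int s"
        using that s by (simp add: syn_def nat_eq_iff2)
      then show ?thesis using diff[OF that] by (simp add: mod_eq_dvd_iff)
    qed
    then have "int s dvd ?d v" using det[of ?d v] v eq by auto
    moreover have "a v < s" "b v < s" using ab v by (auto simp: A_def)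
    ultimately show "a v = b v"
      by (metis mod_eq_dvd_iff mod_less of_nat_eq_iff of_nat_mod)
  qed (auto simp: A_def)
  have "s ^ ?n = card A" using fin by (simp add: A_def card_PiE)
  also have "\<dots> \<le> (\<Sum>c\<in>syn ` A. card {a \<in> A. syn a = c})"
  proof -
    have "A = (\<Union>c\<in>syn ` A. {a \<in> A. syn a = c})" by auto
    then show ?thesis using card_UN_le[of "syn ` A" "\<lambda>c. {a \<in> A. syn a = c}"] finA
      by simp
  qed
  also have "\<dots> \<le> (\<Sum>c\<in>syn ` A. max_wins G s)"
    by (intro sum_mono card_le_max_wins fin win)
  also have "\<dots> \<le> s ^ ?m * max_wins G s"
    using card_mono[OF _ rng] J by (simp add: card_PiE finite_PiE)
  finally have "real s ^ ?n \<le> real s ^ ?m * max_wins G s"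
    by (metis of_nat_le_iff of_nat_mult of_nat_power)
  then have "log s (real s ^ ?n) \<le> log s (real s ^ ?m * max_wins G s)"
    using s by (intro log_mono) auto
  then have "real ?n \<le> ?m + log s (max_wins G s)"
    using s max_wins_pos[OF G, of s] by (simp add: log_mult log_nat_power)
  moreover have "log s (max_wins G s) \<le> gn G"
    unfolding gn_eq_SUP[OF G] gn_s_eq_log_max_wins[OF G s, symmetric]
    using gn_s_tendsto_gn(2)[OF G] s by (intro cSUP_upper) auto
  ultimately show ?thesis by linarith
qed

section \<open>Linear algebra modulo 5 on the Hoffman--Singleton graph\<close>

lemma mod5_numerals:
  "(5::5) = 0" "(6::5) = 1" "(7::5) = 2" "(8::5) = 3" "(9::5) = 4" "(10::5) = 0"
  "(11::5) = 1" "(12::5) = 2" "(13::5) = 3" "(14::5) = 4" "(15::5) = 0" "(16::5) = 1"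
  by simp_all

text \<open>Removing subtraction puts linear expressions over the field of five elements into the normal form
  with coefficients in \<open>{0, 1, 2, 3, 4}\<close>, which decides their equality.\<close>
lemma mod5_minus: "- x = 4 * x" "x - y = x + 4 * y" for x y :: 5
proof -
  have "5 * x = 0" for x :: 5 by (simp add: mod5_numerals(1))
  then have "4 * x + x = 0" for x :: 5 by (simp add: algebra_simps)
  then show "- x = 4 * x" for x :: 5 by (simp add: neg_eq_iff_add_eq_0 add.commute)
  then show "x - y = x + 4 * y" by (metis diff_conv_add_uminus)
qed

lemma UNIV_5: "(UNIV :: 5 set) = {0, 1, 2, 3, 4}"
proof -
  have "card {0, 1, 2, 3, 4 :: 5} = CARD(5)" by simp
  then show ?thesis by (metis card_subset_eq finite subset_UNIV)
qed

lemma sum_UNIV_5: "(\<Sum>x\<in>UNIV. f x) = f 0 + f 1 + f 2 + f 3 + f 4" for f :: "5 \<Rightarrow> 'b::comm_monoid_add"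
  unfolding UNIV_5 by (simp add: add_ac)

lemma sum_UNIV_shift:
  fixes f :: "'a::{finite,ab_group_add} \<Rightarrow> 'b::comm_monoid_add"
  shows "(\<Sum>x\<in>UNIV. f (c + x)) = (\<Sum>x\<in>UNIV. f x)"
  by (rule sum.reindex_bij_witness[of _ "\<lambda>x. x - c" "\<lambda>x. c + x"]) auto

lemma all_5: "(\<forall>x::5. R x) \<longleftrightarrow> R 0 \<and> R 1 \<and> R 2 \<and> R 3 \<and> R 4"
  using UNIV_5 by (metis UNIV_I insertE empty_iff)

lemma square_5_neq: "(x::5)^2 \<noteq> 2" "(x::5)^2 \<noteq> 3"
proof -
  have "\<forall>x::5. x^2 \<noteq> 2 \<and> x^2 \<noteq> 3"
    unfolding all_5 by (simp add: power2_eq_square mod5_numerals)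
  then show "(x::5)^2 \<noteq> 2" "(x::5)^2 \<noteq> 3" by auto
qed

text \<open>The rows of \<open>A - 2 I\<close> for the Hoffman--Singleton graph with adjacency matrix \<open>A\<close>, applied to the vector
  with value \<open>P h j\<close> at \<open>Cyc h j\<close> and \<open>Q i j\<close> at \<open>CoCyc i j\<close>.\<close>
definition cyc_check :: "(5 \<Rightarrow> 5 \<Rightarrow> 5) \<Rightarrow> (5 \<Rightarrow> 5 \<Rightarrow> 5) \<Rightarrow> 5 \<Rightarrow> 5 \<Rightarrow> 5" where
  "cyc_check P Q h j = P h (j + 1) + P h (j - 1) - 2 * P h j + (\<Sum>i\<in>UNIV. Q i (h * i + j))"

definition cocyc_check :: "(5 \<Rightarrow> 5 \<Rightarrow> 5) \<Rightarrow> (5 \<Rightarrow> 5 \<Rightarrow> 5) \<Rightarrow> 5 \<Rightarrow> 5 \<Rightarrow> 5" where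
  "cocyc_check P Q i j = Q i (j + 2) + Q i (j - 2) - 2 * Q i j + (\<Sum>h\<in>UNIV. P h (j - h * i))"

text \<open>The row at \<open>Cyc h x\<close> contains the second difference of \<open>P h\<close> at \<open>x\<close>. A second difference of the rows at
  the co-cycles, in any direction, involves the \<open>P h\<close> only through second differences with steps 1 and 2;
  a step-2 difference is a combination of three step-1 differences, with coefficients 1, 2, 1. So the
  \<open>P h\<close> can be eliminated, and modulo 5 only a multiple of the total of \<open>Q\<close> survives.\<close>
lemma second_differences_at_0:
  fixes P Q :: "5 \<Rightarrow> 5 \<Rightarrow> 5"
  defines "g \<equiv> cyc_check P Q" and "k \<equiv> cocyc_check P Q"
  assumes t: "(\<Sum>i\<in>UNIV. \<Sum>y\<in>UNIV. Q i y) = 0" and g0: "\<And>h x. g h x = 0"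
  shows "k 0 1 + k 0 4 - 2 * k 0 0 = 0" "k 1 0 + k 4 0 - 2 * k 0 0 = 0" "k 1 1 + k 4 4 - 2 * k 0 0 = 0"
proof -
  let ?t = "\<Sum>i\<in>UNIV. \<Sum>y\<in>UNIV. Q i y"
  note expand = g_def k_def cyc_check_def cocyc_check_def sum_UNIV_5
  have "k 0 1 + k 0 4 - 2 * k 0 0 = (\<Sum>h\<in>UNIV. g h 0) - ?t"
    unfolding expand by (simp add: mod5_minus mod5_numerals algebra_simps)
  then show "k 0 1 + k 0 4 - 2 * k 0 0 = 0" using t g0 by simp
  have "k 1 0 + k 4 0 - 2 * k 0 0 = g 1 0 + g 4 0 + (g 2 1 + 2 * g 2 0 + g 2 4)
      + (g 3 1 + 2 * g 3 0 + g 3 4) - 2 * ?t"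
    unfolding expand by (simp add: mod5_minus mod5_numerals algebra_simps)
  then show "k 1 0 + k 4 0 - 2 * k 0 0 = 0" using t g0 by simp
  have "k 1 1 + k 4 4 - 2 * k 0 0 = g 0 0 + g 2 0 + (g 3 1 + 2 * g 3 0 + g 3 4)
      + (g 4 1 + 2 * g 4 0 + g 4 4) - 2 * ?t"
    unfolding expand by (simp add: mod5_minus mod5_numerals algebra_simps)
  then show "k 1 1 + k 4 4 - 2 * k 0 0 = 0" using t g0 by simp
qed

text \<open>The translation \<open>(i, y) \<mapsto> (a + i, b + y)\<close> of the co-cycle vertices extends to an automorphism of the
  graph, which carries the identities at the origin to any other place.\<close>
lemma cyc_check_translate:
  "cyc_check (\<lambda>h x. P h (b - h * a + x)) (\<lambda>i y. Q (a + i) (b + y)) h x = cyc_check P Q h (b - h * a + x)"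
proof -
  have "(\<Sum>i\<in>UNIV. Q i (h * i + (b - h * a + x))) = (\<Sum>i\<in>UNIV. Q (a + i) (h * (a + i) + (b - h * a + x)))"
    by (rule sum_UNIV_shift[symmetric])
  also have "\<dots> = (\<Sum>i\<in>UNIV. Q (a + i) (b + (h * i + x)))" by (simp add: algebra_simps)
  finally show ?thesis by (simp add: cyc_check_def algebra_simps)
qed

lemma cocyc_check_translate:
  "cocyc_check (\<lambda>h x. P h (b - h * a + x)) (\<lambda>i y. Q (a + i) (b + y)) i y = cocyc_check P Q (a + i) (b + y)"
  by (simp add: cocyc_check_def algebra_simps)

lemma sum_all_translate: "(\<Sum>i\<in>UNIV. \<Sum>y\<in>UNIV. Q (a + i) (b + y)) = (\<Sum>i\<in>UNIV. \<Sum>y\<in>UNIV. Q i y)"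
  for Q :: "5 \<Rightarrow> 5 \<Rightarrow> 5"
  by (simp only: sum_UNIV_shift sum_UNIV_shift[of "\<lambda>i. \<Sum>y\<in>UNIV. Q i y" a])

lemma second_differences:
  fixes P Q :: "5 \<Rightarrow> 5 \<Rightarrow> 5"
  assumes t: "(\<Sum>i\<in>UNIV. \<Sum>y\<in>UNIV. Q i y) = 0" and g0: "\<And>h x. cyc_check P Q h x = 0"
  shows "cocyc_check P Q a (b + 1) + cocyc_check P Q a (b + 4) - 2 * cocyc_check P Q a b = 0"
    "cocyc_check P Q (a + 1) b + cocyc_check P Q (a + 4) b - 2 * cocyc_check P Q a b = 0"
    "cocyc_check P Q (a + 1) (b + 1) + cocyc_check P Q (a + 4) (b + 4) - 2 * cocyc_check P Q a b = 0"
proof -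
  note * = second_differences_at_0[of "\<lambda>i y. Q (a + i) (b + y)" "\<lambda>h x. P h (b - h * a + x)",
      unfolded cyc_check_translate cocyc_check_translate sum_all_translate add_0_right, OF t g0]
  show "cocyc_check P Q a (b + 1) + cocyc_check P Q a (b + 4) - 2 * cocyc_check P Q a b = 0"
    by (rule *(1))
  show "cocyc_check P Q (a + 1) b + cocyc_check P Q (a + 4) b - 2 * cocyc_check P Q a b = 0"
    by (rule *(2))
  show "cocyc_check P Q (a + 1) (b + 1) + cocyc_check P Q (a + 4) (b + 4) - 2 * cocyc_check P Q a b = 0"
    by (rule *(3))
qed

lemma arithmetic_progression_5:
  fixes f :: "5 \<Rightarrow> 5"
  assumes "\<And>x. f (x + 1) + f (x + 4) - 2 * f x = 0"
  shows "f x = f 0 + x * (f 1 - f 0)"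
proof -
  have *: "f (x + 1) = 2 * f x - f (x + 4)" for x using assms[of x] by (simp add: algebra_simps)
  have 2: "f 2 = 2 * f 1 - f 0" using *[of 1] by (simp add: mod5_numerals)
  have 3: "f 3 = 3 * f 1 - 2 * f 0" using *[of 2] 2 by (simp add: mod5_numerals algebra_simps)
  have 4: "f 4 = 4 * f 1 - 3 * f 0" using *[of 3] 2 3 by (simp add: mod5_numerals algebra_simps)
  have "\<forall>x. f x = f 0 + x * (f 1 - f 0)"
    unfolding all_5 using 2 3 4 by (simp add: algebra_simps)
  then show ?thesis ..
qed

text \<open>Vanishing second differences in the two coordinate directions leave the functions
  \<open>\<alpha> + \<beta> a + \<gamma> b + \<delta> a b\<close>; the second difference along the diagonal is \<open>2 \<delta>\<close>.\<close>
lemma affine_5_2: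
  fixes k :: "5 \<Rightarrow> 5 \<Rightarrow> 5"
  assumes y: "\<And>a b. k a (b + 1) + k a (b + 4) - 2 * k a b = 0"
    and i: "\<And>a b. k (a + 1) b + k (a + 4) b - 2 * k a b = 0"
    and d: "k 1 1 + k 4 4 - 2 * k 0 0 = 0"
    and 0: "k 0 0 = 0" "k 0 1 = 0" "k 1 0 = 0"
  shows "k a b = 0"
proof -
  have col: "k a b = k a 0 + b * (k a 1 - k a 0)" for a b
    using arithmetic_progression_5[of "k a", OF y] .
  have row: "k a b = k 0 b + a * (k 1 b - k 0 b)" for a b
    using arithmetic_progression_5[of "\<lambda>a. k a b", OF i] .
  have ab: "k a b = a * b * k 1 1" for a b
    using col[of a b] row[of a 0] row[of a 1] 0 by (simp add: algebra_simps)
  have "2 * k 1 1 = 0" using d 0(1) ab[of 4 4] by (simp add: mod5_numerals mod5_minus)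
  \<comment> \<open>3 is the inverse of 2 modulo 5.\<close>
  then have "3 * (2 * k 1 1) = 0" by simp
  then have "k 1 1 = 0" unfolding mult.assoc[symmetric] by (simp add: mod5_numerals)
  then show ?thesis unfolding ab[of a b] by simp
qed

lemma sum_cyc_check:
  "(\<Sum>x\<in>UNIV. cyc_check P Q h x) = (\<Sum>i\<in>UNIV. \<Sum>y\<in>UNIV. Q i y)"
proof -
  have "(\<Sum>x\<in>UNIV. \<Sum>i\<in>UNIV. Q i (h * i + x)) = (\<Sum>i\<in>UNIV. \<Sum>x\<in>UNIV. Q i (h * i + x))"
    by (rule sum.swap)
  also have "\<dots> = (\<Sum>i\<in>UNIV. \<Sum>y\<in>UNIV. Q i y)" by (simp only: sum_UNIV_shift)
  moreover have "(\<Sum>x\<in>UNIV. P h (x + 1) + P h (x - 1) - 2 * P h x) = 0"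
    unfolding sum_UNIV_5 by (simp add: mod5_minus mod5_numerals algebra_simps)
  ultimately show ?thesis by (simp add: cyc_check_def sum.distrib)
qed

text \<open>The first moment is insensitive to \<open>P\<close>, because \<open>x\<close> has second difference zero, also around the cycle
  modulo 5. What matters is that the right-hand side is affine in \<open>h\<close>.\<close>
lemma moment_cyc_check:
  "(\<Sum>x\<in>UNIV. x * cyc_check P Q h x)
     = (\<Sum>i\<in>UNIV. \<Sum>y\<in>UNIV. y * Q i y) - h * (\<Sum>i\<in>UNIV. i * (\<Sum>y\<in>UNIV. Q i y))"
proof -
  have *: "(\<Sum>x\<in>UNIV. x * Q i (h * i + x)) = (\<Sum>y\<in>UNIV. y * Q i y) - h * i * (\<Sum>y\<in>UNIV. Q i y)" for i
  proof -
    have "(\<Sum>x\<in>UNIV. x * Q i (h * i + x)) = (\<Sum>x\<in>UNIV. ((h * i + x) - h * i) * Q i (h * i + x))"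
      by simp
    also have "\<dots> = (\<Sum>y\<in>UNIV. (y - h * i) * Q i y)"
      by (rule sum_UNIV_shift[of "\<lambda>y. (y - h * i) * Q i y"])
    finally show ?thesis by (simp add: left_diff_distrib sum_subtractf sum_distrib_left)
  qed
  have "(\<Sum>x\<in>UNIV. x * (\<Sum>i\<in>UNIV. Q i (h * i + x))) = (\<Sum>i\<in>UNIV. \<Sum>x\<in>UNIV. x * Q i (h * i + x))"
    unfolding sum_distrib_left by (rule sum.swap)
  also have "\<dots> = (\<Sum>i\<in>UNIV. \<Sum>y\<in>UNIV. y * Q i y) - h * (\<Sum>i\<in>UNIV. i * (\<Sum>y\<in>UNIV. Q i y))"
    unfolding * by (simp add: sum_subtractf sum_distrib_left mult.assoc)
  moreover have "(\<Sum>x\<in>UNIV. x * (P h (x + 1) + P h (x - 1) - 2 * P h x)) = 0"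
    unfolding sum_UNIV_5 by (simp add: mod5_minus mod5_numerals algebra_simps)
  ultimately show ?thesis by (simp add: cyc_check_def sum.distrib distrib_left)
qed

text \<open>This is the statement that \<open>A - 2 I\<close> has rank at most 21 modulo 5. The 21 rows are chosen so that the
  moment relations determine the remaining rows at the cycles, and so that an affine function on the
  co-cycles is known from its values at three points.\<close>
lemma hs_checks_complete:
  fixes P Q :: "5 \<Rightarrow> 5 \<Rightarrow> 5"
  defines "g \<equiv> cyc_check P Q" and "k \<equiv> cocyc_check P Q"
  assumes g: "\<And>h. g h 0 = 0" "\<And>h. g h 1 = 0" "\<And>h. g h 2 = 0" "g 0 3 = 0" "g 0 4 = 0" "g 1 3 = 0"
    and k: "k 0 0 = 0" "k 0 1 = 0" "k 1 0 = 0"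
  shows "g h x = 0" "k i y = 0"
proof -
  let ?t = "\<Sum>i\<in>UNIV. \<Sum>y\<in>UNIV. Q i y"
  have sum: "g h 3 + g h 4 = ?t" for h
    using sum_cyc_check[of P Q h] g(1-3)[of h] unfolding g_def by (simp add: sum_UNIV_5)
  have t: "?t = 0" using sum[of 0] g(4,5) by simp
  have moment: "3 * g h 3 + 4 * g h 4 = (\<Sum>i\<in>UNIV. \<Sum>y\<in>UNIV. y * Q i y) - h * (\<Sum>i\<in>UNIV. i * (\<Sum>y\<in>UNIV. Q i y))" for h
    
  proof -
    have "3 * g h 3 + 4 * g h 4 = (\<Sum>x\<in>UNIV. x * g h x)"
      unfolding sum_UNIV_5 by (simp add: g(1-3))
    then show ?thesis unfolding g_def moment_cyc_check .
  qed
  have "g 1 4 = 0" using sum[of 1] t g(6) by simp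
  then have M: "(\<Sum>i\<in>UNIV. \<Sum>y\<in>UNIV. y * Q i y) = 0" "(\<Sum>i\<in>UNIV. i * (\<Sum>y\<in>UNIV. Q i y)) = 0"
    using moment[of 0] moment[of 1] g(4-6) by simp_all
  have 3: "g h 3 = 0" for h
  proof -
    \<comment> \<open>The two moment equations for the two unknown rows have determinant 1.\<close>
    have "g h 3 = 4 * (g h 3 + g h 4) - (3 * g h 3 + 4 * g h 4)" by (simp add: algebra_simps)
    then show ?thesis unfolding sum moment using t M by simp
  qed
  then have 4: "g h 4 = 0" for h using sum[of h] t by simp
  have all: "g h x = 0" for h x
  proof -
    have "\<forall>x. g h x = 0" unfolding all_5 using g(1-3) 3 4 by simp
    then show ?thesis ..
  qed
  then show "g h x = 0" .
  note sd = second_differences[OF t all[unfolded g_def], folded k_def]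
  have "k 1 1 + k 4 4 - 2 * k 0 0 = 0" using sd(3)[of 0 0] by (simp only: add_0)
  then show "k i y = 0" by (rule affine_5_2[of k, OF sd(1,2) _ k])
qed

section \<open>The Hoffman--Singleton graph\<close>

lemma hoffman_singleton_edge_iff:
  "{Cyc h j, Cyc h' k} \<in> edges hoffman_singleton_graph \<longleftrightarrow> h = h' \<and> (k = j + 1 \<or> k = j - 1)"
  "{CoCyc i j, CoCyc i' k} \<in> edges hoffman_singleton_graph \<longleftrightarrow> i = i' \<and> (k = j + 2 \<or> k = j - 2)"
  "{Cyc h j, CoCyc i k} \<in> edges hoffman_singleton_graph \<longleftrightarrow> k = h * i + j"
  "{CoCyc i k, Cyc h j} \<in> edges hoffman_singleton_graph \<longleftrightarrow> k = h * i + j"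
  unfolding hoffman_singleton_graph_def by (auto simp: doubleton_eq_iff)

lemma card_hoffman_singleton: "card (verts hoffman_singleton_graph) = 50"
proof -
  have "(UNIV :: hs_vertex set) = range (case_prod Cyc) \<union> range (case_prod CoCyc)"
    by (auto simp: image_iff) (metis hs_vertex.exhaust)
  moreover have "card (range (case_prod Cyc) \<union> range (case_prod CoCyc)) = card (range (case_prod Cyc)) + card (range (case_prod CoCyc))"
    by (intro card_Un_disjoint) auto
  moreover have "card (range (case_prod Cyc)) = 25" "card (range (case_prod CoCyc)) = 25"
    by (subst card_image; force simp: inj_on_def UNIV_Times_UNIV[symmetric] card_cartesian_product simp del: UNIV_Times_UNIV)+
  ultimately show ?thesis by (simp add: hoffman_singleton_graph_def)
qed

lemma triangle_free_hoffman_singleton: "triangle_free hoffman_singleton_graph"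
proof -
  have step: "x + 1 \<noteq> x" "x - 1 \<noteq> x" "x + 2 \<noteq> x" "x - 2 \<noteq> x" for x :: 5
    by simp_all
  have odd: False
    if "y = x + c \<or> y = x - c" "z = y + c \<or> z = y - c" "z = x + c \<or> z = x - c" "c = 1 \<or> c = 2"
    for x y z c :: 5
    using that by (auto simp: mod5_minus mod5_numerals add.assoc)
  show ?thesis unfolding triangle_free_def
  proof clarify
    fix u v w
    assume "{u, v} \<in> edges hoffman_singleton_graph" "{v, w} \<in> edges hoffman_singleton_graph"
      "{u, w} \<in> edges hoffman_singleton_graph"
    then show False
      by (cases u; cases v; cases w; simp only: hoffman_singleton_edge_iff)
        (use odd[where c = 1] odd[where c = 2] step in \<open>auto simp: algebra_simps\<close>)
  qed
qed

text \<open>The parabola \<open>j = h\<^sup>2\<close> meets each cycle in one vertex. By completing the square,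
  \<open>h i + h\<^sup>2 = (h + 3 i)\<^sup>2 + i\<^sup>2\<close> modulo 5, so its neighbours in the \<open>i\<close>-th co-cycle are the vertices
  \<open>i\<^sup>2\<close> plus a square. Adding the non-squares 2 and 3 to \<open>i\<^sup>2\<close> instead gives the two vertices not
  adjacent to the parabola; they differ by 1, hence are not adjacent.\<close>
lemma gn_hoffman_singleton_le: "gn hoffman_singleton_graph \<le> 35"
proof -
  let ?p = "\<lambda>h::5. Cyc h (h\<^sup>2)" and ?q = "\<lambda>(i::5, c). CoCyc i (i\<^sup>2 + c)"
  let ?I = "range ?p \<union> ?q ` (UNIV \<times> {2, 3})"
  have "card ?I = card (range ?p) + card (?q ` (UNIV \<times> {2, 3}))"
    by (intro card_Un_disjoint) auto
  also have "card (range ?p) = 5" by (subst card_image) (auto simp: inj_on_def)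
  also have "card (?q ` (UNIV \<times> {2, 3})) = 10"
    by (subst card_image) (auto simp: inj_on_def card_cartesian_product)
  finally have card: "card ?I = 15" by simp
  have cross: "i\<^sup>2 + c \<noteq> h * i + h\<^sup>2" if "c = 2 \<or> c = 3" for h i c :: 5
  proof
    assume eq: "i\<^sup>2 + c = h * i + h\<^sup>2"
    have "(h + 3 * i)\<^sup>2 = h * i + h\<^sup>2 + 4 * i\<^sup>2"
      by (simp add: power2_eq_square algebra_simps mod5_numerals)
    also have "\<dots> = 5 * i\<^sup>2 + c" unfolding eq[symmetric] by (simp add: algebra_simps)
    finally have "(h + 3 * i)\<^sup>2 = c" by (simp add: mod5_numerals)
    then show False using square_5_neq that by auto
  qed
  have "gn hoffman_singleton_graph \<le> real (card (verts hoffman_singleton_graph)) - real (card ?I)"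
  proof (rule gn_le_independent)
    fix u v assume "u \<in> ?I" "v \<in> ?I"
    then consider h h' where "u = ?p h" "v = ?p h'" | h i c where "u = ?p h" "v = CoCyc i (i\<^sup>2 + c)" "c = 2 \<or> c = 3"
      | h i c where "v = ?p h" "u = CoCyc i (i\<^sup>2 + c)" "c = 2 \<or> c = 3"
      | i c i' c' where "u = CoCyc i (i\<^sup>2 + c)" "v = CoCyc i' (i'\<^sup>2 + c')" "c = 2 \<or> c = 3" "c' = 2 \<or> c' = 3"
      by auto
    then show "{u, v} \<notin> edges hoffman_singleton_graph"
    proof cases
      case 1
      then show ?thesis by (auto simp: hoffman_singleton_edge_iff)
    next
      case 2
      then show ?thesis using cross by (simp add: hoffman_singleton_edge_iff)
    next
      case 3
      then show ?thesis using cross by (simp add: hoffman_singleton_edge_iff)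
    next
      case 4
      then show ?thesis
        by (auto simp: hoffman_singleton_edge_iff add.assoc mod5_minus mod5_numerals)
    qed
  qed (auto simp: simple_graph_hoffman_singleton, auto simp: hoffman_singleton_graph_def)
  then show ?thesis unfolding card card_hoffman_singleton by simp
qed

text \<open>The same rows over the integers, as the checks of the strategy.\<close>
definition hs_check :: "hs_vertex \<Rightarrow> (hs_vertex \<Rightarrow> int) \<Rightarrow> int" where
  "hs_check v D = (case v of
      Cyc h j \<Rightarrow> D (Cyc h (j + 1)) + D (Cyc h (j - 1)) - 2 * D (Cyc h j) + (\<Sum>i\<in>UNIV. D (CoCyc i (h * i + j)))
    | CoCyc i j \<Rightarrow> D (CoCyc i (j + 2)) + D (CoCyc i (j - 2)) - 2 * D (CoCyc i j) + (\<Sum>h\<in>UNIV. D (Cyc h (j - h * i))))"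

definition hs_basis :: "hs_vertex list" where
  "hs_basis = [Cyc h j. h \<leftarrow> [0, 1, 2, 3, 4], j \<leftarrow> [0, 1, 2]]
     @ [Cyc 0 3, Cyc 0 4, Cyc 1 3, CoCyc 0 0, CoCyc 0 1, CoCyc 1 0]"

lemma of_int_5_eq_0_iff: "(of_int z :: 5) = 0 \<longleftrightarrow> 5 dvd z"
  using of_int_eq_0_iff_char_dvd[of z, where 'a = 5] by simp

text \<open>If \<open>d\<close> is zero around \<open>v\<close>, the row of \<open>A - 2 I\<close> at \<open>v\<close> reduces to \<open>- 2 d v\<close>, and 2 is invertible
  modulo 5.\<close>
lemma gn_hoffman_singleton_ge: "29 \<le> gn hoffman_singleton_graph"
proof -
  have "real (card (verts hoffman_singleton_graph)) - real (card (set hs_basis)) \<le> gn hoffman_singleton_graph"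
  proof (rule gn_ge_additive_checks[where s = 5 and \<Phi> = hs_check])
    show "hs_check v (\<lambda>u. a u - b u) = hs_check v a - hs_check v b" for v a b
      by (simp add: hs_check_def sum_subtractf split: hs_vertex.split)
    fix D v
    assume checks: "\<And>u. u \<in> set hs_basis \<Longrightarrow> int 5 dvd hs_check u D"
      and nbrs: "\<And>u. u \<in> nbhd hoffman_singleton_graph v \<Longrightarrow> D u = 0"
    have D: "D u = 0" if "{u, v} \<in> edges hoffman_singleton_graph" for u using nbrs that
      by (simp add: nbhd_def)
    define P where "P h j = (of_int (D (Cyc h j)) :: 5)" for h j
    define Q where "Q i j = (of_int (D (CoCyc i j)) :: 5)" for i j
    have cyc: "of_int (hs_check (Cyc h j) D) = cyc_check P Q h j" for h j
      by (simp add: hs_check_def cyc_check_def P_def Q_def)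
    have cocyc: "of_int (hs_check (CoCyc i j) D) = cocyc_check P Q i j" for i j
      by (simp add: hs_check_def cocyc_check_def P_def Q_def)
    have basis: "(of_int (hs_check u D) :: 5) = 0" if "u \<in> set hs_basis" for u
      using checks[OF that] by (simp only: of_int_5_eq_0_iff of_nat_numeral)
    have all: "cyc_check P Q h x = 0" "cocyc_check P Q i y = 0" for h x i y
    proof -
      have "\<forall>h. cyc_check P Q h 0 = 0 \<and> cyc_check P Q h 1 = 0 \<and> cyc_check P Q h 2 = 0"
        unfolding all_5 cyc[symmetric] by (intro conjI; rule basis; simp add: hs_basis_def)
      moreover have "cyc_check P Q 0 3 = 0" "cyc_check P Q 0 4 = 0" "cyc_check P Q 1 3 = 0"
        unfolding cyc[symmetric] by (rule basis; simp add: hs_basis_def)+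
      moreover have "cocyc_check P Q 0 0 = 0" "cocyc_check P Q 0 1 = 0" "cocyc_check P Q 1 0 = 0"
        unfolding cocyc[symmetric] by (rule basis; simp add: hs_basis_def)+
      ultimately show "cyc_check P Q h x = 0" "cocyc_check P Q i y = 0"
        using hs_checks_complete[of P Q] by blast+
    qed
    have "(of_int (hs_check v D) :: 5) = 0" using all by (cases v) (simp_all add: cyc cocyc)
    moreover have "hs_check v D = - 2 * D v"
    proof (cases v)
      case (Cyc h j)
      have "D (Cyc h (j + 1)) = 0" "D (Cyc h (j - 1)) = 0" "D (CoCyc i (h * i + j)) = 0" for i
        using Cyc by (auto intro!: D simp: hoffman_singleton_edge_iff)
      then show ?thesis using Cyc by (simp add: hs_check_def)
    next
      case (CoCyc i j)
      have "D (CoCyc i (j + 2)) = 0" "D (CoCyc i (j - 2)) = 0" "D (Cyc h (j - h * i)) = 0" for h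
        using CoCyc by (auto intro!: D simp: hoffman_singleton_edge_iff)
      then show ?thesis using CoCyc by (simp add: hs_check_def)
    qed
    ultimately have "5 dvd - 2 * D v" by (simp only: of_int_5_eq_0_iff)
    then show "int 5 dvd D v" by presburger
  qed (simp_all add: simple_graph_hoffman_singleton)
  moreover have "card (set hs_basis) \<le> 21"
    using card_length[of hs_basis] by (simp add: hs_basis_def)
  ultimately show ?thesis unfolding card_hoffman_singleton by linarith
qed

section \<open>Point-block structures\<close>

lemma sum_over_incident:
  fixes D :: "'a set \<Rightarrow> int"
  assumes "finite \<B>" "finite Y"
  shows "(\<Sum>i\<in>Y. \<Sum>b\<in>{b\<in>\<B>. i \<in> b}. D b) = (\<Sum>b\<in>\<B>. int (card (Y \<inter> b)) * D b)"
proof -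
  have "(\<Sum>i\<in>Y. \<Sum>b\<in>{b\<in>\<B>. i \<in> b}. D b) = (\<Sum>b\<in>\<B>. \<Sum>i\<in>{i\<in>Y. i \<in> b}. D b)"
    by (rule sum.swap_restrict[OF assms(2,1)])
  also have "\<dots> = (\<Sum>b\<in>\<B>. int (card (Y \<inter> b)) * D b)"
    by (simp add: Int_def)
  finally show ?thesis .
qed

text \<open>Adding all of \<open>D\<close> to the sums of \<open>D\<close> through the points of \<open>b\<close> counts \<open>D c\<close> with weight
  \<open>1 + card (b \<inter> c)\<close>. The weight kills every block that meets \<open>b\<close> without being \<open>b\<close>, and \<open>b\<close> itself
  has weight 1 modulo \<open>s\<close>.\<close>
lemma block_determined:
  fixes D :: "'a set \<Rightarrow> int" and s :: int
  assumes fin: "finite \<B>" "finite b" and b: "b \<in> \<B>"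
    and size: "s dvd int (card b)"
    and meet: "\<And>c. c \<in> \<B> \<Longrightarrow> c \<noteq> b \<Longrightarrow> b \<inter> c \<noteq> {} \<Longrightarrow> s dvd 1 + int (card (b \<inter> c))"
    and D: "\<And>c. c \<in> \<B> \<Longrightarrow> b \<inter> c = {} \<Longrightarrow> D c = 0"
    and total: "s dvd (\<Sum>c\<in>\<B>. D c)"
    and points: "s dvd (\<Sum>i\<in>b. \<Sum>c\<in>{c\<in>\<B>. i \<in> c}. D c)"
  shows "s dvd D b"
proof -
  let ?w = "\<lambda>c. (1 + int (card (b \<inter> c))) * D c"
  have "(\<Sum>c\<in>\<B>. ?w c) = (\<Sum>c\<in>\<B>. D c) + (\<Sum>i\<in>b. \<Sum>c\<in>{c\<in>\<B>. i \<in> c}. D c)"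
    by (simp add: sum_over_incident[OF fin] distrib_right sum.distrib)
  then have "s dvd (\<Sum>c\<in>\<B>. ?w c)" using total points by simp
  moreover have "(\<Sum>c\<in>\<B>. ?w c) = ?w b + (\<Sum>c\<in>\<B> - {b}. ?w c)"
    by (rule sum.remove[OF fin(1) b])
  moreover have "s dvd (\<Sum>c\<in>\<B> - {b}. ?w c)"
  proof (rule dvd_sum)
    fix c assume "c \<in> \<B> - {b}"
    then show "s dvd ?w c" using meet[of c] D[of c] by (cases "b \<inter> c = {}") auto
  qed
  ultimately have "s dvd ?w b" by (simp add: dvd_add_left_iff)
  moreover have "?w b = D b + int (card b) * D b" by (simp add: distrib_right)
  ultimately show ?thesis using size by (simp add: dvd_add_left_iff)
qed

text \<open>The rows of \<open>A + I\<close> at the points, together with the total over the blocks, control the rows at the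
  blocks and at the extra vertex: in a sum of point rows over a block the extra vertex occurs \<open>k\<close>
  times, hence cancels, and in the sum over all points the blocks cancel in the same way while the
  extra vertex keeps the coefficient \<open>card X\<close>, which is 1 modulo \<open>s\<close>.\<close>
lemma point_block_checks:
  fixes dinf :: int and dp :: "'a \<Rightarrow> int" and D :: "'a set \<Rightarrow> int" and s :: int
  assumes X: "finite X" "s dvd int (card X) - 1"
    and blocks: "\<And>b. b \<in> \<B> \<Longrightarrow> b \<subseteq> X" "\<And>b. b \<in> \<B> \<Longrightarrow> card b = k" "s dvd int k"
    and meet: "\<And>b c. b \<in> \<B> \<Longrightarrow> c \<in> \<B> \<Longrightarrow> b \<noteq> c \<Longrightarrow> b \<inter> c \<noteq> {} \<Longrightarrow> s dvd 1 + int (card (b \<inter> c))"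
    and points: "\<And>i. i \<in> X \<Longrightarrow> s dvd dinf + dp i + (\<Sum>b\<in>{b\<in>\<B>. i \<in> b}. D b)"
    and total: "s dvd (\<Sum>b\<in>\<B>. D b)"
  shows "(\<And>i. i \<in> X \<Longrightarrow> dp i = 0) \<Longrightarrow> s dvd dinf"
    and "\<lbrakk>b \<in> \<B>; \<And>i. i \<in> b \<Longrightarrow> dp i = 0; \<And>c. c \<in> \<B> \<Longrightarrow> b \<inter> c = {} \<Longrightarrow> D c = 0\<rbrakk> \<Longrightarrow> s dvd D b"
proof -
  have finB: "finite \<B>" using X(1) blocks(1)
    by (meson Pow_iff finite_Pow_iff finite_subset subsetI)
  have sums: "s dvd int (card Y) * dinf + (\<Sum>i\<in>Y. \<Sum>b\<in>{b\<in>\<B>. i \<in> b}. D b)"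
    if "Y \<subseteq> X" "\<And>i. i \<in> Y \<Longrightarrow> dp i = 0" for Y
  proof -
    have "s dvd (\<Sum>i\<in>Y. dinf + (\<Sum>b\<in>{b\<in>\<B>. i \<in> b}. D b))"
      using points that by (intro dvd_sum) (metis add.right_neutral subsetD)
    then show ?thesis by (simp add: sum.distrib)
  qed
  {
    assume dp: "\<And>i. i \<in> X \<Longrightarrow> dp i = 0"
    have "(\<Sum>i\<in>X. \<Sum>b\<in>{b\<in>\<B>. i \<in> b}. D b) = (\<Sum>b\<in>\<B>. int k * D b)"
      unfolding sum_over_incident[OF finB X(1)]
      by (intro sum.cong refl) (metis blocks(1,2) Int_absorb1)
    then have "s dvd int (card X) * dinf + int k * (\<Sum>b\<in>\<B>. D b)"
      using sums[OF subset_refl dp] by (simp add: sum_distrib_left)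
    then have "s dvd int (card X) * dinf" using total by (simp add: dvd_add_left_iff)
    then have "s dvd int (card X) * dinf - (int (card X) - 1) * dinf"
      using X(2) by (meson dvd_diff dvd_mult2)
    then show "s dvd dinf" by (simp add: algebra_simps)
  next
    assume b: "b \<in> \<B>" and dp: "\<And>i. i \<in> b \<Longrightarrow> dp i = 0"
      and D: "\<And>c. c \<in> \<B> \<Longrightarrow> b \<inter> c = {} \<Longrightarrow> D c = 0"
    have "s dvd int k * dinf + (\<Sum>i\<in>b. \<Sum>c\<in>{c\<in>\<B>. i \<in> c}. D c)"
      using sums[OF blocks(1)[OF b] dp] blocks(2)[OF b] by simp
    then have "s dvd (\<Sum>i\<in>b. \<Sum>c\<in>{c\<in>\<B>. i \<in> c}. D c)"
      using blocks(3) by (simp add: dvd_add_right_iff)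
    then show "s dvd D b"
      using b blocks finB finite_subset[OF blocks(1)[OF b] X(1)] total D meet
      by (intro block_determined[of \<B> b s D]) auto
  }
qed

text \<open>A common form of the Clebsch graph (points 1 to 5, blocks the 2-subsets) and the Higman--Sims graph:
  an extra vertex \<open>w\<close> joined to all points, points joined to the blocks containing them, disjoint blocks
  joined.\<close>
lemma gn_point_block_ge:
  fixes X :: "'a set" and \<B> :: "'a set set" and s :: nat
    and pt :: "'a \<Rightarrow> 'v" and bl :: "'a set \<Rightarrow> 'v"
  assumes G: "simple_graph G" and s: "2 \<le> s"
    and verts: "verts G \<subseteq> {w} \<union> pt ` X \<union> bl ` \<B>"
    and edges: "\<And>i. i \<in> X \<Longrightarrow> {w, pt i} \<in> edges G"
      "\<And>i b. i \<in> X \<Longrightarrow> b \<in> \<B> \<Longrightarrow> i \<in> b \<Longrightarrow> {pt i, bl b} \<in> edges G"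
      "\<And>b c. b \<in> \<B> \<Longrightarrow> c \<in> \<B> \<Longrightarrow> b \<inter> c = {} \<Longrightarrow> {bl b, bl c} \<in> edges G"
    and X: "finite X" "int s dvd int (card X) - 1"
    and blocks: "\<And>b. b \<in> \<B> \<Longrightarrow> b \<subseteq> X" "\<And>b. b \<in> \<B> \<Longrightarrow> card b = k" "int s dvd int k"
    and meet: "\<And>b c. b \<in> \<B> \<Longrightarrow> c \<in> \<B> \<Longrightarrow> b \<noteq> c \<Longrightarrow> b \<inter> c \<noteq> {} \<Longrightarrow> int s dvd 1 + int (card (b \<inter> c))"
  shows "real (card (verts G)) - real (card X + 1) \<le> gn G"
proof -
  define J where "J = insert None (Some ` X)"
  let ?x = "\<lambda>i D. \<Sum>b\<in>{b\<in>\<B>. i \<in> b}. D (bl b)"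
  define \<Phi> where "\<Phi> j D = (case j of None \<Rightarrow> (\<Sum>b\<in>\<B>. D (bl b)) | Some i \<Rightarrow> D w + D (pt i) + ?x i D)"
    for j and D :: "'v \<Rightarrow> int"
  have "card J = card X + 1"
    unfolding J_def using X(1) by (subst card_insert_disjoint) (auto simp: card_image)
  moreover have "real (card (verts G)) - real (card J) \<le> gn G"
  proof (rule gn_ge_additive_checks[where s = s and \<Phi> = \<Phi>])
    show "\<Phi> j (\<lambda>v. a v - b v) = \<Phi> j a - \<Phi> j b" for j a b
      by (simp add: \<Phi>_def sum_subtractf split: option.split)
    fix D v
    assume checks: "\<And>j. j \<in> J \<Longrightarrow> int s dvd \<Phi> j D" and v: "v \<in> verts G"
      and nbrs: "\<And>u. u \<in> nbhd G v \<Longrightarrow> D u = 0"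
    have D: "D u = 0" if "{u, v} \<in> edges G" for u using nbrs that by (simp add: nbhd_def)
    have total: "int s dvd (\<Sum>b\<in>\<B>. D (bl b))" using checks[of None]
      by (simp add: J_def \<Phi>_def)
    have points: "int s dvd D w + D (pt i) + ?x i D" if "i \<in> X" for i
      using checks[of "Some i"] that by (simp add: J_def \<Phi>_def)
    note det = point_block_checks[where X = X and \<B> = \<B> and k = k and s = "int s" and dinf = "D w"
        and dp = "\<lambda>i. D (pt i)" and D = "\<lambda>b. D (bl b)"]
    from v verts consider "v = w" | i where "i \<in> X" "v = pt i" | b where "b \<in> \<B>" "v = bl b"
      by blast
    then show "int s dvd D v"
    proof cases
      case 1
      show ?thesis unfolding 1
      proof (rule det(1))
        show "D (pt i) = 0" if "i \<in> X" for i
          using D[of "pt i"] edges(1)[OF that] 1 by (simp add: insert_commute)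
      qed (fact X blocks meet points total)+
    next
      case 2
      have "?x i D = 0" using D edges(2) 2 by (intro sum.neutral) (auto simp: insert_commute)
      moreover have "D w = 0" using D edges(1) 2 by simp
      ultimately show ?thesis using points[OF 2(1)] 2(2) by simp
    next
      case 3
      show ?thesis unfolding 3(2)
      proof (rule det(2))
        show "D (pt i) = 0" if "i \<in> b" for i using D edges(2) 3 blocks(1)[OF 3(1)] that by blast
        show "D (bl c) = 0" if "c \<in> \<B>" "b \<inter> c = {}" for c
          using D[of "bl c"] edges(3)[of c b] 3 that by (simp add: Int_commute)
      qed (fact X blocks meet points total 3)+
    qed
  next
    show "finite J" using X(1) by (simp add: J_def)
  qed (use G s in simp_all)
  ultimately show ?thesis by simp
qed

section \<open>The Steiner system S(3,6,22)\<close>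

locale S_3_6_22_points =
  fixes X :: "'a set" and \<B> :: "'a set set"
  assumes steiner: "steiner_system 3 6 X \<B>" and card_X: "card X = 22"
begin

lemma finite_X: "finite X" using steiner by (simp add: steiner_system_def)
lemma finite_blocks: "finite \<B>" using steiner by (rule steiner_system_finite)
lemma block: "b \<in> \<B> \<Longrightarrow> b \<subseteq> X" "b \<in> \<B> \<Longrightarrow> card b = 6"
  using steiner by (auto simp: steiner_system_def)
lemma finite_block: "b \<in> \<B> \<Longrightarrow> finite b" using block(2)
  by (metis card.infinite zero_neq_numeral)

lemma ex1_block_superset:
  assumes "T \<subseteq> X" "card T = 3"
  shows "\<exists>!b. b \<in> \<B> \<and> T \<subseteq> b"
proof -
  have "\<forall>T. T \<subseteq> X \<and> card T = 3 \<longrightarrow> (\<exists>!b. b \<in> \<B> \<and> T \<subseteq> b)"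
    using steiner unfolding steiner_system_def by (elim conjE)
  from this[rule_format, OF conjI, OF assms] show ?thesis .
qed

lemma ex1_block:
  assumes "p \<in> X" "q \<in> X" "r \<in> X" "p \<noteq> q" "p \<noteq> r" "q \<noteq> r"
  shows "\<exists>!b. b \<in> \<B> \<and> p \<in> b \<and> q \<in> b \<and> r \<in> b"
proof -
  have "{p, q, r} \<subseteq> X" "card {p, q, r} = 3" using assms by auto
  then have "\<exists>!b. b \<in> \<B> \<and> {p, q, r} \<subseteq> b"
    by (rule ex1_block_superset)
  then show ?thesis by simp
qed

lemma card_Int_le_2:
  assumes "b \<in> \<B>" "c \<in> \<B>" "b \<noteq> c"
  shows "card (b \<inter> c) \<le> 2"
proof (rule ccontr)
  assume "\<not> ?thesis"
  then have "3 \<le> card (b \<inter> c)" by linarith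
  then obtain T where "T \<subseteq> b \<inter> c" and card: "card T = 3"
    by (rule obtain_subset_with_card_n)
  then have T: "T \<subseteq> b" "T \<subseteq> c" by blast+
  have "T \<subseteq> X" using T(1) block(1)[OF assms(1)] by (rule subset_trans)
  from ex1_block_superset[OF this card] have "b = c"
    using assms(1,2) T by (elim ex1E) metis
  then show False using assms(3) by contradiction
qed

lemma card_blocks_through_2:
  assumes "p \<in> X" "q \<in> X" "p \<noteq> q"
  shows "card {b \<in> \<B>. p \<in> b \<and> q \<in> b} = 5"
proof -
  let ?N = "{b \<in> \<B>. p \<in> b \<and> q \<in> b}"
  have "(\<Sum>b\<in>?N. card {r \<in> X - {p, q}. r \<in> b}) = 1 * card (X - {p, q})"
  proof (rule sum_multicount)
    have "card {b \<in> ?N. r \<in> b} = 1" if "r \<in> X - {p, q}" for r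
    proof -
      have "\<exists>!b. b \<in> \<B> \<and> p \<in> b \<and> q \<in> b \<and> r \<in> b"
        using ex1_block assms that by blast
      then obtain b where "{b \<in> ?N. r \<in> b} = {b}" by blast
      then show ?thesis by simp
    qed
    then show "\<forall>r\<in>X - {p, q}. card {b \<in> ?N. r \<in> b} = 1" by blast
  qed (use finite_blocks finite_X in auto)
  moreover have "card {r \<in> X - {p, q}. r \<in> b} = 4" if "b \<in> ?N" for b
  proof -
    have "{r \<in> X - {p, q}. r \<in> b} = b - {p, q}" using block(1) that by auto
    then show ?thesis using that assms block(2)[of b] finite_block[of b]
      by (simp add: card_Diff_subset)
  qed
  ultimately have "4 * card ?N = card (X - {p, q})" by simp
  also have "\<dots> = 20" using assms card_X finite_X by (simp add: card_Diff_subset)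
  finally show ?thesis by simp
qed

lemma card_blocks_through:
  assumes "p \<in> X"
  shows "card {b \<in> \<B>. p \<in> b} = 21"
proof -
  let ?N = "{b \<in> \<B>. p \<in> b}"
  have "(\<Sum>b\<in>?N. card {q \<in> X - {p}. q \<in> b}) = 5 * card (X - {p})"
  proof (rule sum_multicount)
    have "{b \<in> ?N. q \<in> b} = {b \<in> \<B>. p \<in> b \<and> q \<in> b}" for q by auto
    then show "\<forall>q\<in>X - {p}. card {b \<in> ?N. q \<in> b} = 5"
      using card_blocks_through_2 assms by auto
  qed (use finite_blocks finite_X in auto)
  moreover have "card {q \<in> X - {p}. q \<in> b} = 5" if "b \<in> ?N" for b
  proof -
    have "{q \<in> X - {p}. q \<in> b} = b - {p}" using block(1) that by auto
    then show ?thesis using that block(2)[of b] by simp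
  qed
  ultimately show ?thesis using assms card_X by simp
qed

lemma card_blocks: "card \<B> = 77"
proof -
  have "(\<Sum>b\<in>\<B>. card {q \<in> X. q \<in> b}) = 21 * card X"
    by (rule sum_multicount) (use finite_blocks finite_X card_blocks_through in auto)
  moreover have "card {q \<in> X. q \<in> b} = 6" if "b \<in> \<B>" for b
  proof -
    have "{q \<in> X. q \<in> b} = b" using block(1) that by auto
    then show ?thesis using that block(2)[of b] by simp
  qed
  ultimately show ?thesis using card_X by simp
qed

lemma card_blocks_missing:
  assumes "p \<in> X"
  shows "card {b \<in> \<B>. p \<notin> b} = 56"
proof -
  have "{b \<in> \<B>. p \<notin> b} = \<B> - {b \<in> \<B>. p \<in> b}" by auto
  then show ?thesis
    using card_blocks card_blocks_through[OF assms] finite_blocks by (simp add: card_Diff_subset)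
qed

lemma card_blocks_missing_through:
  assumes "p \<in> X" "q \<in> X" "p \<noteq> q"
  shows "card {b \<in> \<B>. p \<notin> b \<and> q \<in> b} = 16"
proof -
  have "{b \<in> \<B>. p \<notin> b \<and> q \<in> b} = {b \<in> \<B>. q \<in> b} - {b \<in> \<B>. p \<in> b \<and> q \<in> b}"
    by auto
  moreover have "card ({b \<in> \<B>. q \<in> b} - {b \<in> \<B>. p \<in> b \<and> q \<in> b})
      = card {b \<in> \<B>. q \<in> b} - card {b \<in> \<B>. p \<in> b \<and> q \<in> b}"
    using finite_blocks by (intro card_Diff_subset) auto
  ultimately show ?thesis
    using card_blocks_through_2[OF assms] card_blocks_through[OF assms(2)] by simp
qed

text \<open>After deleting a common point, the blocks through it become the lines of a projective plane of order 4, where two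
  lines meet. Concretely, if \<open>p\<close> were the only common point and \<open>q\<close> another point of \<open>c\<close>, then the five
  blocks through \<open>p\<close>, \<open>q\<close> and one of the remaining points of \<open>b\<close> would be distinct; but only five blocks
  contain \<open>p\<close> and \<open>q\<close>, so \<open>c\<close> would be among them.\<close>
lemma card_Int_eq_2:
  assumes "b \<in> \<B>" "c \<in> \<B>" "b \<noteq> c" "b \<inter> c \<noteq> {}"
  shows "card (b \<inter> c) = 2"
proof (rule ccontr)
  assume "card (b \<inter> c) \<noteq> 2"
  moreover have "card (b \<inter> c) \<noteq> 0" using assms(4) finite_block[OF assms(1)] by simp
  ultimately have "card (b \<inter> c) = 1" using card_Int_le_2[OF assms(1-3)] by linarith
  then obtain p where p: "b \<inter> c = {p}" by (auto simp: card_1_singleton_iff)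
  then have pb: "p \<in> b" by auto
  have "card (c - {p}) \<noteq> 0" using block(2)[OF assms(2)] p
    by (simp add: card_Diff_singleton_if)
  then have "c - {p} \<noteq> {}" by (metis card.empty)
  then obtain q where q: "q \<in> c" "q \<noteq> p" by blast
  have pq: "p \<in> X" "q \<in> X" "q \<notin> b"
    using p q block(1)[OF assms(1)] block(1)[OF assms(2)] by auto
  let ?N = "{d \<in> \<B>. p \<in> d \<and> q \<in> d}"
  define f where "f r = (THE d. d \<in> \<B> \<and> p \<in> d \<and> q \<in> d \<and> r \<in> d)" for r
  have f: "f r \<in> \<B> \<and> p \<in> f r \<and> q \<in> f r \<and> r \<in> f r"
    if "r \<in> b - {p}" for r
  proof -
    have "\<exists>!d. d \<in> \<B> \<and> p \<in> d \<and> q \<in> d \<and> r \<in> d"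
      using that pq q block(1)[OF assms(1)] by (intro ex1_block) auto
    then show ?thesis unfolding f_def by (rule theI')
  qed
  have "inj_on f (b - {p})"
  proof (rule inj_onI, rule ccontr)
    fix r r' assume r: "r \<in> b - {p}" "r' \<in> b - {p}" "f r = f r'" "r \<noteq> r'"
    have "{p, r, r'} \<subseteq> b \<inter> f r" using f[OF r(1)] f[OF r(2)] r p by auto
    then have "card {p, r, r'} \<le> card (b \<inter> f r)" using finite_block[OF assms(1)]
      by (intro card_mono) auto
    moreover have "card {p, r, r'} = 3" using r by auto
    moreover have "f r \<noteq> b" using f[OF r(1)] pq by auto
    ultimately show False using card_Int_le_2[OF assms(1), of "f r"] f[OF r(1)] by auto
  qed
  then have "card (f ` (b - {p})) = 5"
    using block(2)[OF assms(1)] pb by (simp add: card_image)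
  moreover have "f ` (b - {p}) \<subseteq> ?N" using f by auto
  moreover have "card ?N = 5" using card_blocks_through_2 pq q by auto
  moreover have "finite ?N" using finite_blocks by simp
  ultimately have "f ` (b - {p}) = ?N" by (metis card_subset_eq)
  moreover have "c \<in> ?N" using assms p q by auto
  ultimately have "c \<in> f ` (b - {p})" by (simp only:)
  then obtain r where "r \<in> b - {p}" "f r = c" by blast
  then show False using f[of r] p by auto
qed

text \<open>Each of the 15 pairs of points of \<open>b\<close> lies with \<open>x\<close> in exactly one block, so 15 of the 21 blocks
  through \<open>x\<close> meet \<open>b\<close>.\<close>
lemma card_disjoint_through:
  assumes "b \<in> \<B>" "x \<in> X" "x \<notin> b"
  shows "card {c \<in> \<B>. x \<in> c \<and> b \<inter> c = {}} = 6"
proof -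
  let ?M = "{c \<in> \<B>. x \<in> c \<and> b \<inter> c \<noteq> {}}"
  have "(\<Sum>c\<in>?M. card {q \<in> b. q \<in> c}) = 5 * card b"
  proof (rule sum_multicount)
    have "card {c \<in> ?M. q \<in> c} = 5" if "q \<in> b" for q
    proof -
      have "{c \<in> ?M. q \<in> c} = {c \<in> \<B>. x \<in> c \<and> q \<in> c}" using that by auto
      moreover have "q \<in> X" "x \<noteq> q" using that block(1)[OF assms(1)] assms(3) by auto
      ultimately show ?thesis using card_blocks_through_2[OF assms(2)] by simp
    qed
    then show "\<forall>q\<in>b. card {c \<in> ?M. q \<in> c} = 5" by blast
  qed (use finite_blocks finite_block[OF assms(1)] in auto)
  moreover have "card {q \<in> b. q \<in> c} = 2" if "c \<in> ?M" for c
    using card_Int_eq_2[OF assms(1), of c] that assms(3) by (auto simp: Int_def)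
  ultimately have M: "card ?M = 15" using block(2)[OF assms(1)] by simp
  have "{c \<in> \<B>. x \<in> c \<and> b \<inter> c = {}} = {c \<in> \<B>. x \<in> c} - ?M" by auto
  moreover have "card ({c \<in> \<B>. x \<in> c} - ?M) = card {c \<in> \<B>. x \<in> c} - card ?M"
    using finite_blocks by (intro card_Diff_subset) auto
  ultimately show ?thesis using M card_blocks_through[OF assms(2)] by simp
qed

lemma card_disjoint:
  assumes "b \<in> \<B>"
  shows "card {c \<in> \<B>. b \<inter> c = {}} = 16"
proof -
  let ?N = "{c \<in> \<B>. b \<inter> c = {}}"
  have "(\<Sum>c\<in>?N. card {x \<in> X - b. x \<in> c}) = 6 * card (X - b)"
  proof (rule sum_multicount)
    have "{c \<in> ?N. x \<in> c} = {c \<in> \<B>. x \<in> c \<and> b \<inter> c = {}}" for x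
      by auto
    then show "\<forall>x\<in>X - b. card {c \<in> ?N. x \<in> c} = 6"
      using card_disjoint_through[OF assms] by auto
  qed (use finite_blocks finite_X in auto)
  moreover have "card {x \<in> X - b. x \<in> c} = 6" if "c \<in> ?N" for c
  proof -
    have "{x \<in> X - b. x \<in> c} = c" using block(1)[of c] that by auto
    then show ?thesis using that block(2)[of c] by simp
  qed
  moreover have "card (X - b) = 16"
    using block[OF assms] card_X finite_block[OF assms] by (simp add: card_Diff_subset)
  ultimately show ?thesis by simp
qed

text \<open>Of the 16 blocks disjoint from \<open>b\<close>, one is \<open>c\<close>, and 15 meet \<open>c\<close> properly: through each of the six points
  of \<open>c\<close> there are five of them, and each is counted twice. None is left to be disjoint from \<open>c\<close>.\<close>
lemma no_three_disjoint:
  assumes "b \<in> \<B>" "c \<in> \<B>" "d \<in> \<B>" "b \<inter> c = {}" "b \<inter> d = {}"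
  shows "c \<inter> d \<noteq> {}"
proof
  assume cd: "c \<inter> d = {}"
  let ?N = "{e \<in> \<B>. b \<inter> e = {}}" and ?M = "{e \<in> \<B>. b \<inter> e = {} \<and> e \<noteq> c \<and> c \<inter> e \<noteq> {}}"
  have "(\<Sum>e\<in>?M. card {x \<in> c. x \<in> e}) = 5 * card c"
  proof (rule sum_multicount)
    have "card {e \<in> ?M. x \<in> e} = 5" if "x \<in> c" for x
    proof -
      have "{e \<in> ?M. x \<in> e} = {e \<in> \<B>. x \<in> e \<and> b \<inter> e = {}} - {c}"
        using that by auto
      moreover have "c \<in> {e \<in> \<B>. x \<in> e \<and> b \<inter> e = {}}" using that assms
        by auto
      moreover have "x \<in> X" "x \<notin> b" using that assms(4) block(1)[OF assms(2)] by auto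
      ultimately show ?thesis using card_disjoint_through[OF assms(1)] by simp
    qed
    then show "\<forall>x\<in>c. card {e \<in> ?M. x \<in> e} = 5" by blast
  qed (use finite_blocks finite_block[OF assms(2)] in auto)
  moreover have "card {x \<in> c. x \<in> e} = 2" if "e \<in> ?M" for e
    using card_Int_eq_2[OF assms(2), of e] that by (auto simp: Int_def)
  ultimately have M: "card ?M = 15" using block(2)[OF assms(2)] by simp
  have "c \<noteq> {}" "finite ?M" using block(2)[OF assms(2)] finite_blocks by auto
  then have "c \<noteq> d" "c \<notin> ?M" "d \<notin> ?M" using cd by auto
  then have "card (insert c (insert d ?M)) = 17" using M \<open>finite ?M\<close> by simp
  moreover have "card (insert c (insert d ?M)) \<le> card ?N"
    using assms finite_blocks by (intro card_mono) auto
  ultimately show False using card_disjoint[OF assms(1)] by simp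
qed

lemma dvd_3_meet:
  assumes "b \<in> \<B>" "c \<in> \<B>" "b \<noteq> c" "b \<inter> c \<noteq> {}"
  shows "3 dvd 1 + int (card (b \<inter> c))"
  using card_Int_eq_2[OF assms] by simp

end

section \<open>Disjointness graphs: the Gewirtz and M22 graphs\<close>

lemma disjointness_edge_iff:
  "{b, c} \<in> edges (disjointness_graph \<B>) \<longleftrightarrow> b \<in> \<B> \<and> c \<in> \<B> \<and> b \<inter> c = {}"
  unfolding disjointness_graph_def by (auto simp: doubleton_eq_iff)

lemma disjointness_verts [simp]: "verts (disjointness_graph \<B>) = \<B>"
  by (simp add: disjointness_graph_def)

lemma disjointness_nbhd: "nbhd (disjointness_graph \<B>) b = {c. b \<in> \<B> \<and> c \<in> \<B> \<and> b \<inter> c = {}}"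
  unfolding nbhd_def disjointness_edge_iff by auto

locale S_3_6_22_system =
  fixes \<B> :: "nat set set"
  assumes S: "S_3_6_22 \<B>"
begin

sublocale S_3_6_22_points "{1..22}" \<B>
  using S by unfold_locales auto

lemma triangle_free_disjointness: "\<C> \<subseteq> \<B> \<Longrightarrow> triangle_free (disjointness_graph \<C>)"
  unfolding triangle_free_def disjointness_edge_iff by (meson no_three_disjoint subsetD)

lemma simple_graph_subsystem: "\<C> \<subseteq> \<B> \<Longrightarrow> simple_graph (disjointness_graph \<C>)"
  using finite_subset[OF _ finite_blocks, of \<C>] block(2)[of "{}"]
    by (intro simple_graph_disjointness) auto

lemma gn_disjointness_le:
  assumes "\<C> \<subseteq> \<B>"
  shows "gn (disjointness_graph \<C>) \<le> real (card \<C>) - real (card {b \<in> \<C>. q \<in> b})"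
  using gn_le_independent[OF simple_graph_subsystem[OF assms], of "{b \<in> \<C>. q \<in> b}"]
  by (auto simp: disjointness_edge_iff)

lemma sum_points_total:
  fixes D :: "nat set \<Rightarrow> int"
  assumes "\<C> \<subseteq> \<B>" "Y \<subseteq> {1..22}" "\<And>b. b \<in> \<C> \<Longrightarrow> b \<subseteq> Y"
  shows "(\<Sum>i\<in>Y. \<Sum>b\<in>{b\<in>\<C>. i \<in> b}. D b) = 6 * (\<Sum>b\<in>\<C>. D b)"
proof -
  have fin: "finite \<C>" "finite Y" using assms finite_blocks finite_subset by blast+
  have "card (Y \<inter> b) = 6" if "b \<in> \<C>" for b
  proof -
    have "Y \<inter> b = b" using assms(3)[OF that] by blast
    then show ?thesis using assms(1) that block(2)[of b] by auto
  qed
  then show ?thesis unfolding sum_over_incident[OF fin] sum_distrib_left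
    by (intro sum.cong) simp_all
qed

lemma subsystem_block_determined:
  fixes D :: "nat set \<Rightarrow> int"
  assumes "\<C> \<subseteq> \<B>" "b \<in> \<C>" "\<And>u. u \<in> nbhd (disjointness_graph \<C>) b \<Longrightarrow> D u = 0"
    "3 dvd (\<Sum>c\<in>\<C>. D c)" "3 dvd (\<Sum>i\<in>b. \<Sum>c\<in>{c\<in>\<C>. i \<in> c}. D c)"
  shows "3 dvd D b"
proof (rule block_determined[of \<C> b 3 D])
  show "finite \<C>" using assms(1) finite_blocks finite_subset by blast
  show "finite b" "3 dvd int (card b)" using assms(1,2) finite_block block(2) by auto
  show "3 dvd 1 + int (card (b \<inter> c))"
    if "c \<in> \<C>" "c \<noteq> b" "b \<inter> c \<noteq> {}" for c
    using dvd_3_meet[of b c] assms(1,2) that by auto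
  show "D c = 0" if "c \<in> \<C>" "b \<inter> c = {}" for c
    using assms(2,3) that by (auto simp: disjointness_nbhd)
qed (use assms in auto)

text \<open>The check at the point 22 follows from the 22 checks used, as all point sums add up to six times the
  total.\<close>
lemma gn_M22_ge: "55 \<le> gn (M22_graph \<B>)"
proof -
  define J :: "nat option set" where "J = insert None (Some ` {1..21})"
  define \<Phi> where "\<Phi> j D = (case j of None \<Rightarrow> (\<Sum>c\<in>\<B>. D c) | Some i \<Rightarrow> (\<Sum>c\<in>{c\<in>\<B>. i \<in> c}. D c))"
    for j :: "nat option" and D :: "nat set \<Rightarrow> int"
  have "card J = 22" unfolding J_def by (subst card_insert_disjoint) (auto simp: card_image)
  moreover have "real (card (verts (disjointness_graph \<B>))) - real (card J) \<le> gn (disjointness_graph \<B>)"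
  proof (rule gn_ge_additive_checks[where s = 3 and \<Phi> = \<Phi>])
    show "\<Phi> j (\<lambda>v. a v - b v) = \<Phi> j a - \<Phi> j b" for j a b
      by (simp add: \<Phi>_def sum_subtractf split: option.split)
    fix D b
    assume checks: "\<And>j. j \<in> J \<Longrightarrow> int 3 dvd \<Phi> j D" and b: "b \<in> verts (disjointness_graph \<B>)"
      and nbrs: "\<And>u. u \<in> nbhd (disjointness_graph \<B>) b \<Longrightarrow> D u = 0"
    let ?x = "\<lambda>i. \<Sum>c\<in>{c\<in>\<B>. i \<in> c}. D c"
    have total: "3 dvd (\<Sum>c\<in>\<B>. D c)" using checks[of None]
      by (simp add: J_def \<Phi>_def)
    have x: "3 dvd ?x i" if "i \<in> {1..21}" for i using checks[of "Some i"] that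
      by (simp add: J_def \<Phi>_def)
    have "{1..22} = insert 22 {1..21::nat}" by auto
    then have "(\<Sum>i=1..22. ?x i) = ?x 22 + (\<Sum>i=1..21. ?x i)" by simp
    then have "?x 22 + (\<Sum>i=1..21. ?x i) = 6 * (\<Sum>c\<in>\<B>. D c)"
      using sum_points_total[of \<B> "{1..22}" D] block(1) by (simp only: subset_refl)
    then have "?x 22 = 6 * (\<Sum>c\<in>\<B>. D c) - (\<Sum>i=1..21. ?x i)"
      by (simp only: eq_diff_eq)
    moreover have "3 dvd 6 * (\<Sum>c\<in>\<B>. D c) - (\<Sum>i=1..21. ?x i)"
    proof (rule dvd_diff)
      show "3 dvd (\<Sum>i=1..21. ?x i)" using x by (rule dvd_sum)
    qed simp
    ultimately have "3 dvd ?x 22" by (simp only:)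
    then have "3 dvd ?x i" if "i \<in> {1..22}" for i
    proof (cases "i = 22")
      case True
      then show ?thesis using \<open>3 dvd ?x 22\<close> by (simp only:)
    next
      case False
      then show ?thesis using that by (intro x) auto
    qed
    then have "3 dvd (\<Sum>i\<in>b. ?x i)" using b block(1)[of b] by (intro dvd_sum[of b]) auto
    then show "int 3 dvd D b"
      using subsystem_block_determined[of \<B> b D] b nbrs total by simp
  next
    show "simple_graph (disjointness_graph \<B>)" by (rule simple_graph_subsystem) simp
    show "finite J" by (simp add: J_def)
  qed simp
  ultimately show ?thesis using card_blocks by (simp add: M22_graph_def)
qed

text \<open>It suffices to check that the point sums agree, since a block has six points, and 6 is 0 modulo 3. Of
  the 20 agreements with the point \<open>r\<close> one is implied: the point sums add up to 0, and there are 21 of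
  them, which is 0 modulo 3 too.\<close>
lemma gn_gewirtz_ge:
  assumes p: "p \<in> {1..22}"
  shows "36 \<le> gn (gewirtz_graph \<B> p)"
proof -
  define \<C> where "\<C> = {b \<in> \<B>. p \<notin> b}"
  have sub: "\<C> \<subseteq> \<B>" by (auto simp: \<C>_def)
  let ?Y = "{1..22} - {p}"
  have "card ?Y = 21" using p by simp
  have "card (?Y) \<noteq> 0" using \<open>card ?Y = 21\<close> by simp
  then obtain q where q: "q \<in> ?Y" by (metis card.empty equals0I)
  have "card (?Y - {q}) = 20" using \<open>card ?Y = 21\<close> q by (simp add: card_Diff_singleton)
  then have "card (?Y - {q}) \<noteq> 0" by simp
  then obtain r where r: "r \<in> ?Y - {q}" by (metis card.empty equals0I)
  define Z where "Z = ?Y - {q} - {r}"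
  have Z: "finite Z" "card Z = 19" "r \<notin> Z" "q \<notin> insert r Z" "?Y = insert q (insert r Z)"
    using \<open>card (?Y - {q}) = 20\<close> q r by (auto simp: Z_def)
  define J where "J = insert None (Some ` Z)"
  let ?x = "\<lambda>i D. \<Sum>c\<in>{c\<in>\<C>. i \<in> c}. D c"
  \<comment> \<open>Point sums are compared with the one at \<open>r\<close>; the comparison at \<open>q\<close> is the implied one.\<close>
  define \<Phi> where "\<Phi> j D = (case j of None \<Rightarrow> (\<Sum>c\<in>\<C>. D c) | Some i \<Rightarrow> ?x i D - ?x r D)"
    for j :: "nat option" and D :: "nat set \<Rightarrow> int"
  have "card J = 20" unfolding J_def using Z(1,2)
    by (subst card_insert_disjoint) (auto simp: card_image)
  moreover have "real (card (verts (disjointness_graph \<C>))) - real (card J) \<le> gn (disjointness_graph \<C>)"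
  proof (rule gn_ge_additive_checks[where s = 3 and \<Phi> = \<Phi>])
    show "\<Phi> j (\<lambda>v. a v - b v) = \<Phi> j a - \<Phi> j b" for j a b
      by (simp add: \<Phi>_def sum_subtractf split: option.split)
    fix D b
    assume checks: "\<And>j. j \<in> J \<Longrightarrow> int 3 dvd \<Phi> j D" and b: "b \<in> verts (disjointness_graph \<C>)"
      and nbrs: "\<And>u. u \<in> nbhd (disjointness_graph \<C>) b \<Longrightarrow> D u = 0"
    let ?d = "\<lambda>i. ?x i D - ?x r D"
    have bC: "b \<in> \<C>" using b by simp
    have bY: "c \<subseteq> ?Y" if "c \<in> \<C>" for c using block(1)[of c] that
      by (auto simp: \<C>_def)
    have total: "3 dvd (\<Sum>c\<in>\<C>. D c)" using checks[of None]
      by (simp add: J_def \<Phi>_def)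
    have d: "3 dvd ?d i" if "i \<in> insert r Z" for i
      using checks[of "Some i"] that by (auto simp: J_def \<Phi>_def)
    have "(\<Sum>i\<in>?Y. ?x i D) = (\<Sum>i\<in>?Y. ?d i + ?x r D)" by simp
    also have "\<dots> = (\<Sum>i\<in>?Y. ?d i) + 21 * ?x r D" 
      using \<open>card ?Y = 21\<close> by (simp only: sum.distrib sum_constant of_nat_numeral)
    also have "(\<Sum>i\<in>?Y. ?d i) = ?d q + (\<Sum>i\<in>insert r Z. ?d i)"
      unfolding Z(5) using Z(1,4) by (subst sum.insert) auto
    finally have "?d q = 6 * (\<Sum>c\<in>\<C>. D c) - 21 * ?x r D - (\<Sum>i\<in>insert r Z. ?d i)"
      using sum_points_total[OF sub, of ?Y D] bY by simp
    moreover have "3 dvd 6 * (\<Sum>c\<in>\<C>. D c) - 21 * ?x r D - (\<Sum>i\<in>insert r Z. ?d i)"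
    proof (rule dvd_diff)
      show "3 dvd (\<Sum>i\<in>insert r Z. ?d i)" using d by (rule dvd_sum)
    qed simp
    ultimately have "3 dvd ?d q" by (simp only:)
    then have dY: "3 dvd ?d i" if "i \<in> ?Y" for i
    proof -
      from that have "i = q \<or> i \<in> insert r Z" unfolding Z(5) by blast
      then show ?thesis using d[of i] \<open>3 dvd ?d q\<close> by (elim disjE) (simp_all only:)
    qed
    have "(\<Sum>i\<in>b. ?x i D) = (\<Sum>i\<in>b. ?d i) + 6 * ?x r D"
      using block(2)[of b] bC sub by (auto simp: sum_subtractf)
    moreover have "3 dvd (\<Sum>i\<in>b. ?d i) + 6 * ?x r D"
    proof (rule dvd_add)
      show "3 dvd (\<Sum>i\<in>b. ?d i)" using dY bY[OF bC] by (intro dvd_sum) blast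
    qed simp
    ultimately have "3 dvd (\<Sum>i\<in>b. ?x i D)" by (simp only:)
    then show "int 3 dvd D b"
      using subsystem_block_determined[OF sub bC nbrs total] by simp
  next
    show "simple_graph (disjointness_graph \<C>)" by (rule simple_graph_subsystem[OF sub])
    show "finite J" using Z(1) by (simp add: J_def)
  qed simp
  moreover have "card \<C> = 56" unfolding \<C>_def by (rule card_blocks_missing[OF p])
  ultimately show ?thesis by (simp add: gewirtz_graph_def \<C>_def)
qed

lemma gewirtz_facts:
  assumes p: "p \<in> {1..22}"
  shows "triangle_free (gewirtz_graph \<B> p)" "card (verts (gewirtz_graph \<B> p)) = 56"
    "gn (gewirtz_graph \<B> p) \<le> 40"
proof -
  define \<C> where "\<C> = {b \<in> \<B>. p \<notin> b}"
  have sub: "\<C> \<subseteq> \<B>" by (auto simp: \<C>_def)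
  have G: "gewirtz_graph \<B> p = disjointness_graph \<C>" by (simp add: gewirtz_graph_def \<C>_def)
  show "triangle_free (gewirtz_graph \<B> p)" unfolding G
    by (rule triangle_free_disjointness[OF sub])
  have card: "card \<C> = 56" unfolding \<C>_def by (rule card_blocks_missing[OF p])
  then show "card (verts (gewirtz_graph \<B> p)) = 56" by (simp add: G)
  obtain q :: nat where q: "q \<in> {1..22}" "p \<noteq> q"
    using that[of "if p = 1 then 2 else 1"] by auto
  have "card {b \<in> \<C>. q \<in> b} = 16"
    using card_blocks_missing_through[OF p q] by (simp add: \<C>_def conj_assoc)
  then show "gn (gewirtz_graph \<B> p) \<le> 40"
    using gn_disjointness_le[OF sub, of q] card unfolding G by simp
qed

lemma M22_facts:
  shows "triangle_free (M22_graph \<B>)" "card (verts (M22_graph \<B>)) = 77" "gn (M22_graph \<B>) \<le> 56"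
  using triangle_free_disjointness[of \<B>] card_blocks card_blocks_through[of 1] gn_disjointness_le[of \<B> 1]
  by (simp_all add: M22_graph_def)

lemma higman_sims_edge_iff:
  "{HInfty} \<notin> edges (higman_sims_graph \<B>)"
  "{HInfty, Point x} \<in> edges (higman_sims_graph \<B>) \<longleftrightarrow> x \<in> {1..22}"
  "{Point x, HInfty} \<in> edges (higman_sims_graph \<B>) \<longleftrightarrow> x \<in> {1..22}"
  "{HInfty, Block b} \<notin> edges (higman_sims_graph \<B>)"
  "{Block b, HInfty} \<notin> edges (higman_sims_graph \<B>)"
  "{Point x, Point y} \<notin> edges (higman_sims_graph \<B>)"
  "{Point x, Block b} \<in> edges (higman_sims_graph \<B>) \<longleftrightarrow> x \<in> {1..22} \<and> b \<in> \<B> \<and> x \<in> b"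
  "{Block b, Point x} \<in> edges (higman_sims_graph \<B>) \<longleftrightarrow> x \<in> {1..22} \<and> b \<in> \<B> \<and> x \<in> b"
  "{Block b, Block c} \<in> edges (higman_sims_graph \<B>) \<longleftrightarrow> b \<in> \<B> \<and> c \<in> \<B> \<and> b \<inter> c = {}"
  unfolding higman_sims_graph_def by (auto simp: doubleton_eq_iff)

lemma card_higman_sims: "card (verts (higman_sims_graph \<B>)) = 100"
proof -
  have "card (Point ` {1..22} \<union> Block ` \<B>) = card (Point ` {1..22}) + card (Block ` \<B>)"
    using finite_blocks by (intro card_Un_disjoint) auto
  also have "\<dots> = 99" using card_blocks by (simp add: card_image inj_on_def)
  finally have "card (insert HInfty (Point ` {1..22} \<union> Block ` \<B>)) = 100"
    using finite_blocks by (subst card_insert_disjoint) auto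
  then show ?thesis by (simp add: higman_sims_graph_def)
qed

lemma triangle_free_higman_sims: "triangle_free (higman_sims_graph \<B>)"
  unfolding triangle_free_def
proof clarify
  fix u v w
  assume "{u, v} \<in> edges (higman_sims_graph \<B>)" "{v, w} \<in> edges (higman_sims_graph \<B>)"
    "{u, w} \<in> edges (higman_sims_graph \<B>)"
  then show False
    by (cases u; cases v; cases w; simp add: higman_sims_edge_iff; metis no_three_disjoint disjoint_iff)
qed

lemma gn_higman_sims_le: "gn (higman_sims_graph \<B>) \<le> 78"
proof -
  have "gn (higman_sims_graph \<B>) \<le> real (card (verts (higman_sims_graph \<B>))) - real (card (Point ` {1..22}))"
  proof (rule gn_le_independent)
    show "simple_graph (higman_sims_graph \<B>)" by (rule simple_graph_higman_sims[OF S])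
    show "Point ` {1..22} \<subseteq> verts (higman_sims_graph \<B>)"
      by (auto simp: higman_sims_graph_def)
  qed (auto simp: higman_sims_edge_iff)
  then show ?thesis unfolding card_higman_sims by (simp add: card_image inj_on_def)
qed

lemma gn_higman_sims_ge: "77 \<le> gn (higman_sims_graph \<B>)"
proof -
  have "real (card (verts (higman_sims_graph \<B>))) - real (card {1..22::nat} + 1) \<le> gn (higman_sims_graph \<B>)"
  proof (rule gn_point_block_ge[where s = 3 and k = 6 and w = HInfty and pt = Point and bl = Block])
    show "verts (higman_sims_graph \<B>) \<subseteq> {HInfty} \<union> Point ` {1..22} \<union> Block ` \<B>"
      by (auto simp: higman_sims_graph_def)
    show "simple_graph (higman_sims_graph \<B>)" by (rule simple_graph_higman_sims[OF S])
    show "int 3 dvd 1 + int (card (b \<inter> c))"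
      if "b \<in> \<B>" "c \<in> \<B>" "b \<noteq> c" "b \<inter> c \<noteq> {}" for b c
      using dvd_3_meet[OF that] by simp
  qed (use block in \<open>simp_all only: higman_sims_edge_iff\<close>, simp_all)
  then show ?thesis unfolding card_higman_sims by simp
qed

end

section \<open>The Clebsch graph\<close>

lemma clebsch_edge_iff:
  "{CInfty} \<notin> edges clebsch_graph"
  "{CInfty, CSet u} \<in> edges clebsch_graph \<longleftrightarrow> u \<subseteq> {1..5} \<and> card u = 1"
  "{CSet u, CInfty} \<in> edges clebsch_graph \<longleftrightarrow> u \<subseteq> {1..5} \<and> card u = 1"
  "{CSet u, CSet v} \<in> edges clebsch_graph \<longleftrightarrow> u \<subseteq> {1..5} \<and> v \<subseteq> {1..5} \<and>
     (card u = 1 \<and> card v = 2 \<and> u \<subseteq> v \<or> card v = 1 \<and> card u = 2 \<and> v \<subseteq> u \<or>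
      card u = 2 \<and> card v = 2 \<and> u \<inter> v = {})"
  unfolding clebsch_graph_def by (auto simp: doubleton_eq_iff)

lemma card_clebsch: "card (verts clebsch_graph) = 16"
proof -
  let ?A = "\<lambda>k. {u. u \<subseteq> {1..5::nat} \<and> card u = k}"
  have fin: "finite (?A k)" for k by (rule finite_subset[of _ "Pow {1..5}"]) auto
  have "card (?A 1 \<union> ?A 2) = card (?A 1) + card (?A 2)"
    using fin by (intro card_Un_disjoint) auto
  also have "\<dots> = 15" by (simp add: n_subsets numeral_eq_Suc)
  finally have "card (CSet ` (?A 1 \<union> ?A 2)) = 15" by (simp add: card_image inj_on_def)
  then have "card (insert CInfty (CSet ` (?A 1 \<union> ?A 2))) = 16"
    using fin by (subst card_insert_disjoint) auto
  moreover have "verts clebsch_graph = insert CInfty (CSet ` (?A 1 \<union> ?A 2))"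
    by (auto simp: clebsch_graph_def)
  ultimately show ?thesis by simp
qed

text \<open>Three pairwise disjoint 2-subsets would need six points, and two 2-subsets that contain a common
  point are not disjoint.\<close>
lemma triangle_free_clebsch: "triangle_free clebsch_graph"
proof -
  have no3: False
    if "u \<subseteq> {1..5::nat}" "v \<subseteq> {1..5}" "w \<subseteq> {1..5}" "card u = 2" "card v = 2" "card w = 2"
    "u \<inter> v = {}" "v \<inter> w = {}" "u \<inter> w = {}" for u v w
  proof -
    have "finite u" "finite v" "finite w" using that(1-3) finite_subset by blast+
    then have "card (u \<union> v \<union> w) = 6" using that(4-9)
      by (simp add: card_Un_disjoint Int_Un_distrib2)
    moreover have "card (u \<union> v \<union> w) \<le> card {1..5::nat}" using that(1-3)
      by (intro card_mono) auto
    ultimately show False by simp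
  qed
  have meet: "u \<inter> v \<noteq> {}"
    if "card w = 1" "w \<subseteq> u" "w \<subseteq> v" for u v w :: "nat set"
    using that by (auto simp: card_1_singleton_iff)
  show ?thesis unfolding triangle_free_def
  proof clarify
    fix u v w
    assume "{u, v} \<in> edges clebsch_graph" "{v, w} \<in> edges clebsch_graph" "{u, w} \<in> edges clebsch_graph"
    then show False
      by (cases u; cases v; cases w; simp add: clebsch_edge_iff) (use no3 meet in \<open>auto 0 3\<close>)
  qed
qed

lemma gn_clebsch_le: "gn clebsch_graph \<le> 11"
proof -
  let ?I = "CSet ` (\<lambda>i. {i}) ` {1..5::nat}"
  have "gn clebsch_graph \<le> real (card (verts clebsch_graph)) - real (card ?I)"
    by (rule gn_le_independent[OF simple_graph_clebsch]) (auto simp: clebsch_edge_iff, auto simp: clebsch_graph_def)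
  then show ?thesis unfolding card_clebsch by (simp add: card_image inj_on_def)
qed

lemma gn_clebsch_ge: "10 \<le> gn clebsch_graph"
proof -
  let ?T = "{u. u \<subseteq> {1..5::nat} \<and> card u = 2}"
  have "real (card (verts clebsch_graph)) - real (card {1..5::nat} + 1) \<le> gn clebsch_graph"
  proof (rule gn_point_block_ge[where s = 2 and k = 2 and w = CInfty and pt = "\<lambda>i. CSet {i}"
        and bl = CSet and \<B> = ?T])
    show "verts clebsch_graph \<subseteq> {CInfty} \<union> (\<lambda>i. CSet {i}) ` {1..5} \<union> CSet ` ?T"
      by (auto simp: clebsch_graph_def card_1_singleton_iff)
    show "int 2 dvd 1 + int (card (b \<inter> c))"
      if "b \<in> ?T" "c \<in> ?T" "b \<noteq> c" "b \<inter> c \<noteq> {}" for b c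
    proof -
      have fin: "finite b" "finite c" using that(1,2) finite_subset by auto
      have "card (b \<inter> c) \<noteq> 2" using that(1-3) fin
        by (metis (mono_tags, lifting) Int_lower1 Int_lower2 card_subset_eq mem_Collect_eq)
      moreover have "card (b \<inter> c) \<le> 2"
        using that(1) card_mono[OF fin(1), of "b \<inter> c"] by auto
      moreover have "card (b \<inter> c) \<noteq> 0" using that(4) fin by auto
      ultimately have "card (b \<inter> c) = 1" by linarith
      then show ?thesis by simp
    qed
  qed (auto simp: clebsch_edge_iff simple_graph_clebsch)
  then show ?thesis unfolding card_clebsch by simp
qed

section \<open>The five graphs\<close>

theorem proposition5p9:
  "(triangle_free clebsch_graph \<and> card (verts clebsch_graph) = 16 \<and>
      gn clebsch_graph > real (card (verts clebsch_graph)) / 2 \<and>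
      10 \<le> gn clebsch_graph \<and> gn clebsch_graph \<le> 11) \<and>
   (triangle_free hoffman_singleton_graph \<and> card (verts hoffman_singleton_graph) = 50 \<and>
      gn hoffman_singleton_graph > real (card (verts hoffman_singleton_graph)) / 2 \<and>
      29 \<le> gn hoffman_singleton_graph \<and> gn hoffman_singleton_graph \<le> 35) \<and>
   (\<forall>\<B> p. S_3_6_22 \<B> \<and> p \<in> {1..22} \<longrightarrow>
      triangle_free (gewirtz_graph \<B> p) \<and> card (verts (gewirtz_graph \<B> p)) = 56 \<and>
      gn (gewirtz_graph \<B> p) > real (card (verts (gewirtz_graph \<B> p))) / 2 \<and>
      36 \<le> gn (gewirtz_graph \<B> p) \<and> gn (gewirtz_graph \<B> p) \<le> 40) \<and>
   (\<forall>\<B>. S_3_6_22 \<B> \<longrightarrow>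
      triangle_free (M22_graph \<B>) \<and> card (verts (M22_graph \<B>)) = 77 \<and>
      gn (M22_graph \<B>) > real (card (verts (M22_graph \<B>))) / 2 \<and>
      55 \<le> gn (M22_graph \<B>) \<and> gn (M22_graph \<B>) \<le> 56) \<and>
   (\<forall>\<B>. S_3_6_22 \<B> \<longrightarrow>
      triangle_free (higman_sims_graph \<B>) \<and> card (verts (higman_sims_graph \<B>)) = 100 \<and>
      gn (higman_sims_graph \<B>) > real (card (verts (higman_sims_graph \<B>))) / 2 \<and>
      77 \<le> gn (higman_sims_graph \<B>) \<and> gn (higman_sims_graph \<B>) \<le> 78)"
proof -
  have clebsch: "triangle_free clebsch_graph \<and> card (verts clebsch_graph) = 16 \<and>
      gn clebsch_graph > real (card (verts clebsch_graph)) / 2 \<and>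
      10 \<le> gn clebsch_graph \<and> gn clebsch_graph \<le> 11"
    using triangle_free_clebsch card_clebsch gn_clebsch_ge gn_clebsch_le by simp
  have hoffman_singleton: "triangle_free hoffman_singleton_graph \<and>
      card (verts hoffman_singleton_graph) = 50 \<and>
      gn hoffman_singleton_graph > real (card (verts hoffman_singleton_graph)) / 2 \<and>
      29 \<le> gn hoffman_singleton_graph \<and> gn hoffman_singleton_graph \<le> 35"
    using triangle_free_hoffman_singleton card_hoffman_singleton
      gn_hoffman_singleton_ge gn_hoffman_singleton_le by simp
  have gewirtz: "triangle_free (gewirtz_graph \<B> p) \<and> card (verts (gewirtz_graph \<B> p)) = 56 \<and>
      gn (gewirtz_graph \<B> p) > real (card (verts (gewirtz_graph \<B> p))) / 2 \<and>
      36 \<le> gn (gewirtz_graph \<B> p) \<and> gn (gewirtz_graph \<B> p) \<le> 40"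
    if "S_3_6_22 \<B>" "p \<in> {1..22}" for \<B> p
  proof -
    interpret S_3_6_22_system \<B> using that(1) by unfold_locales
    show ?thesis using gewirtz_facts[OF that(2)] gn_gewirtz_ge[OF that(2)] by simp
  qed
  have M22: "triangle_free (M22_graph \<B>) \<and> card (verts (M22_graph \<B>)) = 77 \<and>
      gn (M22_graph \<B>) > real (card (verts (M22_graph \<B>))) / 2 \<and>
      55 \<le> gn (M22_graph \<B>) \<and> gn (M22_graph \<B>) \<le> 56"
    if "S_3_6_22 \<B>" for \<B>
  proof -
    interpret S_3_6_22_system \<B> using that by unfold_locales
    show ?thesis using M22_facts gn_M22_ge by simp
  qed
  have higman_sims: "triangle_free (higman_sims_graph \<B>) \<and>
      card (verts (higman_sims_graph \<B>)) = 100 \<and>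
      gn (higman_sims_graph \<B>) > real (card (verts (higman_sims_graph \<B>))) / 2 \<and>
      77 \<le> gn (higman_sims_graph \<B>) \<and> gn (higman_sims_graph \<B>) \<le> 78"
    if "S_3_6_22 \<B>" for \<B>
  proof -
    interpret S_3_6_22_system \<B> using that by unfold_locales
    show ?thesis
      using triangle_free_higman_sims card_higman_sims gn_higman_sims_ge gn_higman_sims_le by simp
  qed
  show ?thesis using clebsch hoffman_singleton gewirtz M22 higman_sims by blast
qed

end
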